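(* Let $f:\mathcal G^2\to\mathcal G^2$ be a $\beta$-train track map representing an automorphism $\alpha$ of $F_n$ ($n\ge2$). For every path $\gamma$ in $\mathcal G^1$ there is a unique normalized path $\gamma_*$ in $\mathcal G^1$ which is (in $\mathcal G^2$) homotopic to $\gamma$ relative to its endpoints.
   Context: **Complex and map.** $\mathcal G^2$ consists of: a disjoint union $X$ (the relative part) of finitely many connected vertex spaces $X_v$; a finite collection $\hat\Gamma$ (the train track part) of edges with endpoints in $X$; and finitely many 2-cells with boundary in $\mathcal G^1:=X\cup\hat\Gamma$. The continuous map $f$ satisfies $f(X)\subset X$, $f(\mathcal G^1)\subset\mathcal G^1$. It represents $\alpha\in\mathrm{Aut}(F_n)$: there is a marking isomorphism $\theta:\pi_1\mathcal G^2\to F_n$ conjugating $f_*$ to the outer automorphism given by $\alpha$. **Paths.** $X$ is a graph and all vertices of $\mathcal G^2$ lie in $X$. A path in $\mathcal G^1$ is an edge path whose first and/or last edge may be only partially traversed, in which case this edge must belong to $\hat\Gamma$. Subpaths contained in $X$ are considered up to homotopy in $X$ rel. endpoints and tacitly taken reduced in the graph $X$. $\bar\gamma$ is $\gamma$ reversed. A path in $\mathcal G^1$ is relative backtracking if it is homotopic rel. endpoints in $\mathcal G^2$ to a path contained in $X$; $\gamma$ is relatively reduced if every relative backtracking subpath of $\gamma$ lies in $X$; $\gamma$ is legal if $f^t(\gamma)$ is relatively reduced for all $t\ge1$. **Partial train track map with Nielsen faces.** Every edge of $\hat\Gamma$ is legal; every edge of $\hat\Gamma$ is expanding (some positive iterate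 of $f$ maps it to an edge path running over at least two edges of $\hat\Gamma$); for every path (or loop) $\gamma$ in $\mathcal G^1$ some $f^t(\gamma)$, $t\ge0$, is homotopic rel. endpoints (freely homotopic) in $\mathcal G^2$ to a legal path (loop) in $\mathcal G^1$. **INPs and auxiliary edges.** An INP is a reduced path $\eta=\eta'\circ\eta''$ in $\mathcal G^1$ whose first and last edges (or non-trivial edge segments) lie in $\hat\Gamma$, such that $\eta',\eta''$ are legal, $f^t(\eta)$ is not legal for any $t\ge0$, and for some $t_0\ge1$ the path $f^{t_0}(\eta)$ is homotopic rel. endpoints in $\mathcal G^1$ to $\eta$. There are finitely many INPs. For every INP $\eta$ there is an associated auxiliary edge $e$ in $X$ with the same endpoints, and a 2-cell (Nielsen face) with boundary path $\bar e\circ\eta$. There is a subgraph $\Gamma\subset\mathcal G^1$ containing $\hat\Gamma$ such that $\mathcal G^1$ is the union of $\Gamma$ and all auxiliary edges, and $X$ consists of the auxiliary edges and the edges of $\Gamma\smallsetminus\hat\Gamma$. (Technically an auxiliary edge is the union of two half-edges meeting at an auxiliary vertex; when three or more auxiliary edges would form a non-trivial loop in $X$ contractible in $\mathcal G^2$, they share a common central auxiliary vertex, so that e.g. three such edges are the pairwise unions of the legs of a tripod.) The map $\hat r:\mathcal G^1\to\mathcal G^1$ is the identity on $\Gamma$ and sends each auxiliary edge to its associated INP; a sufficiently high power of $\hat r$ gives the retraction $r$ of $\mathcal G^1$ onto $\Gamma$, which extends to $r:\mathcal G^2\to\Gamma$. **Strongly legal paths.** A turn is a path $e\circ\chi\circ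 e'$ with $e,e'$ edges (or non-trivial edge segments) of $\hat\Gamma$ and $\chi$ a possibly trivial reduced edge path in $X$; it is legal if it is legal as a path. The tip of an INP $\eta'\circ\eta''$ is the turn from the last $\hat\Gamma$-edge of $\eta'$ to the first $\hat\Gamma$-edge of $\eta''$; it is the only non-legal turn of the INP. A half turn is a path $e\circ\chi$ or $\chi\circ e'$ with $e,e'$ edges (or non-trivial edge segments) of $\hat\Gamma$ and $\chi$ a non-trivial reduced edge path in $X$. A path $\gamma$ is strongly legal if it is legal and the path obtained from $\gamma$ by replacing every auxiliary edge $e_i$ by the INP $\hat r(e_i)$ has as only illegal turns the tips of these INPs. Equivalently, $\gamma$ is legal and all its maximal half turns are strongly legal, where a half turn $e\circ\chi$ (similarly $\chi\circ e'$) fails to be strongly legal iff the first edge of $\chi$ is an auxiliary edge with associated INP $\eta$ and for some $t\ge1$ the first edge of $f^t(\eta)$ equals the first edge of $f^t(\bar e)$. **$\beta$-train track map.** This is a partial train track map with Nielsen faces (that is, a continuous map $f:\mathcal G^2\to\mathcal G^2$ with $f(X)\subset X$ and $f(\mathcal G^1)\subset\mathcal G^1$, such that every edge of $\hat\Gamma$ is legal and expanding, and such that for every path (or loop) $\gamma$ in $\mathcal G^1$ some $f^t(\gamma)$, $t\ge0$, is homotopic rel. endpoints (freely homotopic) in $\mathcal G^2$ to a legal path (loop) in $\mathcal G^1$) satisfying moreover: (a) each $X_v$ is a graph, the marking induces a monomorphism $\pi_1X_v\to F_n$, and every conjugacy class represented by a loop in $X$ has polynomial $\alpha$-growth (its cyclic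 length under $\alpha^t$ is bounded by $Ct^d$); (b) $r:\mathcal G^2\to\Gamma$ is a homotopy equivalence restricting to the identity on $\Gamma$, and $r\circ f|_\Gamma:\Gamma\to\Gamma$ is a relative train track map in the sense of Bestvina–Handel; (c) every edge of $\hat\Gamma$ is strongly legal; (d) $f$ maps strongly legal paths to strongly legal paths; (e) every edge of $\hat\Gamma$ is expanding; (f) lifts of strongly legal paths to the universal covering $\tilde{\mathcal G}^2$ are quasi-geodesics for the simplicial metric (every edge, in $\hat\Gamma$ or in $X$, of length 1), with constants independent of the path; (g) reduced paths in $\Gamma$, and paths mapped by $r$ to reduced paths in $\Gamma$, also lift to quasi-geodesics in $\tilde{\mathcal G}^2$; in particular so does any path derived from a strongly legal path by applying $r$ to a collection of subpaths; (h) for every path $\gamma$ in $\mathcal G^1$ there is $\hat t\ge0$, depending only on the number of illegal turns of $\gamma$ (turns that are not legal or have a maximal sub-half-turn that is not strongly legal), such that $f^{\hat t}(\gamma)$ is homotopic rel. endpoints in $\mathcal G^2$ to a strongly legal path in $\mathcal G^1$. **Normalized paths.** For an auxiliary edge $e$, the reduced path $r(e)$ in $\Gamma$ is called a pre-INP. A pre-INP $r(e)$ in a reduced path $\gamma$ in $\Gamma$ is isolated if any other pre-INP in $\gamma$ that intersects $r(e)$ in more than a point is contained as a subpath in $r(e)$. A path $\gamma$ in $\mathcal G^1$ is normalized if (i) the path $r(\gamma)$ in $\Gamma$ is reduced, and (ii) $\gamma$ is obtained from $r(\gamma)$ by replacing every isolated pre-INP $r(e)$ of $r(\gamma)$ by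 the associated auxiliary edge $e$. *)

theory Defs
  imports "HOL-Analysis.Analysis" "HOL-Algebra.Generated_Groups"
begin

section \<open>Homotopy preliminaries\<close>

text \<open>The library's \<open>subpath\<close> is restricted to normed spaces; this is the same
  function for an arbitrary codomain.\<close>

definition sub_path :: "real \<Rightarrow> real \<Rightarrow> (real \<Rightarrow> 'a) \<Rightarrow> real \<Rightarrow> 'a" where
  "sub_path a b g = (\<lambda>t. g ((b - a) * t + a))"

text \<open>Two paths agree up to (weakly monotone) change of parameter; stalling is allowed on both
  sides, so that the relation is symmetric.\<close>

definition same_up_to_param :: "(real \<Rightarrow> 'a) \<Rightarrow> (real \<Rightarrow> 'a) \<Rightarrow> bool" where
  "same_up_to_param p q \<longleftrightarrow>
     (\<exists>\<phi> \<psi>. continuous_on {0..1} \<phi> \<and> mono_on {0..1} \<phi> \<and> \<phi> 0 = 0 \<and> \<phi> 1 = 1 \<and>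
            continuous_on {0..1} \<psi> \<and> mono_on {0..1} \<psi> \<and> \<psi> 0 = 0 \<and> \<psi> 1 = (1::real) \<and>
            (\<forall>t\<in>{0..1::real}. p (\<phi> t) = q (\<psi> t)))"

text \<open>Paths are considered up to parametrisation and with subpaths contained in \<open>S\<close> taken up to
  homotopy in \<open>S\<close> relative to their endpoints: the least equivalence relation that contains both and
  is compatible with concatenation.\<close>

inductive equiv_mod :: "'a::topological_space set \<Rightarrow> (real \<Rightarrow> 'a) \<Rightarrow> (real \<Rightarrow> 'a) \<Rightarrow> bool"
  for S where
  param: "path p \<Longrightarrow> path q \<Longrightarrow> same_up_to_param p q \<Longrightarrow> equiv_mod S p q"
| homotopic: "homotopic_paths S p q \<Longrightarrow> equiv_mod S p q"
| join: "equiv_mod S p q \<Longrightarrow> equiv_mod S p' q' \<Longrightarrow> pathfinish p = pathstart p' \<Longrightarrow>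
         equiv_mod S (p +++ p') (q +++ q')"
| trans: "equiv_mod S p q \<Longrightarrow> equiv_mod S q s \<Longrightarrow> equiv_mod S p s"

definition is_homotopy_equivalence ::
    "'a::topological_space set \<Rightarrow> 'b::topological_space set \<Rightarrow> ('a \<Rightarrow> 'b) \<Rightarrow> bool" where
  "is_homotopy_equivalence S T h \<longleftrightarrow>
     continuous_on S h \<and> h ` S \<subseteq> T \<and>
     (\<exists>k. continuous_on T k \<and> k ` T \<subseteq> S \<and>
          homotopic_with_canon (\<lambda>_. True) S S (k \<circ> h) id \<and>
          homotopic_with_canon (\<lambda>_. True) T T (h \<circ> k) id)"

definition path_class :: "'a::topological_space set \<Rightarrow> (real \<Rightarrow> 'a) \<Rightarrow> (real \<Rightarrow> 'a) set" where
  "path_class S p = {q. homotopic_paths S p q}"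

definition loops_at :: "'a::topological_space set \<Rightarrow> 'a \<Rightarrow> (real \<Rightarrow> 'a) set" where
  "loops_at S x = {p. path p \<and> path_image p \<subseteq> S \<and> pathstart p = x \<and> pathfinish p = x}"

definition fundamental_group :: "'a::topological_space set \<Rightarrow> 'a \<Rightarrow> (real \<Rightarrow> 'a) set monoid" where
  "fundamental_group S x =
     \<lparr>carrier = path_class S ` loops_at S x,
      monoid.mult = (\<lambda>A B. {s. \<exists>p\<in>A. \<exists>q\<in>B. homotopic_paths S (p +++ q) s}),
      one = path_class S (\<lambda>_. x)\<rparr>"

section \<open>Free groups and growth\<close>

text \<open>A letter \<open>(True, b)\<close> stands for \<open>b\<close> and \<open>(False, b)\<close> for its inverse.\<close>

definition letter_value :: "('g, 'm) monoid_scheme \<Rightarrow> bool \<times> 'g \<Rightarrow> 'g" where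
  "letter_value F l = (if fst l then snd l else inv\<^bsub>F\<^esub> (snd l))"

definition word_value :: "('g, 'm) monoid_scheme \<Rightarrow> (bool \<times> 'g) list \<Rightarrow> 'g" where
  "word_value F w = foldr (\<lambda>l g. letter_value F l \<otimes>\<^bsub>F\<^esub> g) w \<one>\<^bsub>F\<^esub>"

definition free_basis :: "('g, 'm) monoid_scheme \<Rightarrow> 'g set \<Rightarrow> bool" where
  "free_basis F B \<longleftrightarrow> B \<subseteq> carrier F \<and> generate F B = carrier F \<and>
     (\<forall>w. w \<noteq> [] \<and> snd ` set w \<subseteq> B \<and>
          (\<forall>i. Suc i < length w \<longrightarrow>
             \<not> (snd (w ! i) = snd (w ! Suc i) \<and> fst (w ! i) \<noteq> fst (w ! Suc i)))
        \<longrightarrow> word_value F w \<noteq> \<one>\<^bsub>F\<^esub>)"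

definition word_length :: "('g, 'm) monoid_scheme \<Rightarrow> 'g set \<Rightarrow> 'g \<Rightarrow> nat" where
  "word_length F B g = (LEAST k. \<exists>w. length w = k \<and> snd ` set w \<subseteq> B \<and> word_value F w = g)"

definition cyclic_length :: "('g, 'm) monoid_scheme \<Rightarrow> 'g set \<Rightarrow> 'g \<Rightarrow> nat" where
  "cyclic_length F B g =
     (LEAST k. \<exists>h\<in>carrier F. k = word_length F B (h \<otimes>\<^bsub>F\<^esub> g \<otimes>\<^bsub>F\<^esub> inv\<^bsub>F\<^esub> h))"

definition polynomial_growth :: "('g, 'm) monoid_scheme \<Rightarrow> 'g set \<Rightarrow> ('g \<Rightarrow> 'g) \<Rightarrow> 'g \<Rightarrow> bool" where
  "polynomial_growth F B \<alpha> g \<longleftrightarrow>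
     (\<exists>(C::real) (d::nat). \<forall>t\<ge>1. real (cyclic_length F B ((\<alpha> ^^ t) g)) \<le> C * real t ^ d)"

section \<open>The complex\<close>

text \<open>A finite 2-dimensional cell complex inside a Hausdorff space, with the extra structure of the
  Nielsen faces. The edges are those of the train track part (\<open>hat\<close>), the remaining edges of
  the subgraph \<open>\<Gamma>\<close> (\<open>gam\<close>), and the half-edges (\<open>half\<close>). An auxiliary edge \<open>e \<in> aux\<close> is the
  union of the two half-edges \<open>legs e\<close>: it runs along the first from its outer end to the auxiliary
  vertex and from there along the second to the outer end. A face is its characteristic map on the
  closed unit disk.

  A segment \<open>(e, a, b)\<close> traverses the edge \<open>e\<close> from parameter \<open>a\<close> to parameter \<open>b\<close>; thus
  \<open>(e, 0, 1)\<close> is \<open>e\<close> and \<open>(e, 1, 0)\<close> is \<open>e\<close> reversed. The edge path \<open>inp e\<close> is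
  the INP associated with the auxiliary edge \<open>e\<close>, \<open>rhat\<close> and \<open>ret\<close> are the map
  sending auxiliary edges to their INPs and the retraction to \<open>\<Gamma>\<close>, and \<open>rpow\<close> is the power with \<open>ret = rhat ^^ rpow\<close> on the 1-skeleton.\<close>

type_synonym 'e seg = "'e \<times> real \<times> real"

text \<open>An edge path is given by its initial point and its segments; the initial point is needed for
  trivial paths.\<close>

type_synonym ('a, 'e) edge_path = "'a \<times> 'e seg list"

record ('a, 'e) nielsen_complex =
  verts :: "'a set"
  aux_verts :: "'a set"
  hat :: "'e set"
  gam :: "'e set"
  half :: "'e set"
  emap :: "'e \<Rightarrow> real \<Rightarrow> 'a"
  faces :: "(complex \<Rightarrow> 'a) set"
  aux :: "'e set"
  legs :: "'e \<Rightarrow> 'e \<times> 'e"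
  inp :: "'e \<Rightarrow> 'e seg list"
  rhat :: "'a \<Rightarrow> 'a"
  rpow :: nat
  ret :: "'a \<Rightarrow> 'a"

definition cells1 :: "('a, 'e) nielsen_complex \<Rightarrow> 'e set" where
  "cells1 G = hat G \<union> gam G \<union> half G"

definition open_edge :: "('a, 'e) nielsen_complex \<Rightarrow> 'e \<Rightarrow> 'a set" where
  "open_edge G e = emap G e ` {0<..<1}"

definition Gamma :: "('a, 'e) nielsen_complex \<Rightarrow> 'a set" where
  "Gamma G = verts G \<union> (\<Union>e\<in>hat G \<union> gam G. emap G e ` {0..1})"

definition rel_part :: "('a, 'e) nielsen_complex \<Rightarrow> 'a set" where
  "rel_part G = verts G \<union> aux_verts G \<union> (\<Union>e\<in>gam G \<union> half G. emap G e ` {0..1})"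

definition G1 :: "('a, 'e) nielsen_complex \<Rightarrow> 'a set" where
  "G1 G = rel_part G \<union> (\<Union>e\<in>hat G. emap G e ` {0..1})"

definition G2 :: "('a, 'e) nielsen_complex \<Rightarrow> 'a set" where
  "G2 G = G1 G \<union> (\<Union>\<Phi>\<in>faces G. \<Phi> ` cball 0 1)"

definition cell_complex :: "('a::t2_space, 'e) nielsen_complex \<Rightarrow> bool" where
  "cell_complex G \<longleftrightarrow>
     finite (verts G) \<and> finite (aux_verts G) \<and> verts G \<inter> aux_verts G = {} \<and>
     finite (cells1 G) \<and> finite (aux G) \<and> finite (faces G) \<and>
     disjnt (hat G) (gam G) \<and> disjnt (half G) (hat G \<union> gam G) \<and> disjnt (aux G) (cells1 G) \<and>
     (\<forall>e\<in>cells1 G. continuous_on {0..1} (emap G e) \<and> inj_on (emap G e) {0<..<1} \<and>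
        open_edge G e \<inter> (verts G \<union> aux_verts G) = {}) \<and>
     (\<forall>e\<in>cells1 G. \<forall>e'\<in>cells1 G. e \<noteq> e' \<longrightarrow> open_edge G e \<inter> open_edge G e' = {}) \<and>
     (\<forall>e\<in>hat G \<union> gam G. emap G e 0 \<in> verts G \<and> emap G e 1 \<in> verts G) \<and>
     (\<forall>h\<in>half G. emap G h 0 \<in> verts G \<and> emap G h 1 \<in> aux_verts G) \<and>
     (\<forall>\<Phi>\<in>faces G. continuous_on (cball 0 1) \<Phi> \<and> inj_on \<Phi> (ball 0 1) \<and>
        \<Phi> ` sphere 0 1 \<subseteq> G1 G \<and> \<Phi> ` ball 0 1 \<inter> G1 G = {}) \<and>
     (\<forall>\<Phi>\<in>faces G. \<forall>\<Psi>\<in>faces G. \<Phi> \<noteq> \<Psi> \<longrightarrow> \<Phi> ` ball 0 1 \<inter> \<Psi> ` ball 0 1 = {}) \<and>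
     path_connected (G2 G)"

text \<open>An auxiliary vertex is the midpoint of one auxiliary edge, or the common central vertex of
  several ones, which then are the pairwise unions of the half-edges ending there (three of them for
  a tripod).\<close>

definition auxiliary_structure :: "('a, 'e) nielsen_complex \<Rightarrow> bool" where
  "auxiliary_structure G \<longleftrightarrow>
     (\<forall>e\<in>aux G. fst (legs G e) \<in> half G \<and> snd (legs G e) \<in> half G \<and>
        fst (legs G e) \<noteq> snd (legs G e) \<and>
        emap G (fst (legs G e)) 1 = emap G (snd (legs G e)) 1) \<and>
     (\<forall>e\<in>aux G. \<forall>e'\<in>aux G.
        {fst (legs G e), snd (legs G e)} = {fst (legs G e'), snd (legs G e')} \<longrightarrow> e = e') \<and>
     (\<forall>v\<in>aux_verts G. \<exists>h\<in>half G. emap G h 1 = v) \<and>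
     (\<forall>h\<in>half G. \<exists>e\<in>aux G. h = fst (legs G e) \<or> h = snd (legs G e)) \<and>
     (\<forall>h\<in>half G. \<forall>h'\<in>half G. h \<noteq> h' \<and> emap G h 1 = emap G h' 1 \<longrightarrow>
        (\<exists>e\<in>aux G. {h, h'} = {fst (legs G e), snd (legs G e)}))"

section \<open>Edge paths\<close>

text \<open>Parametrisation of an edge, where auxiliary edges count as single edges.\<close>

definition edge_map :: "('a::topological_space, 'e) nielsen_complex \<Rightarrow> 'e \<Rightarrow> real \<Rightarrow> 'a" where
  "edge_map G e =
     (if e \<in> aux G then emap G (fst (legs G e)) +++ reversepath (emap G (snd (legs G e)))
      else emap G e)"

definition rev_seg :: "'e seg \<Rightarrow> 'e seg" where
  "rev_seg s = (fst s, snd (snd s), fst (snd s))"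

definition rev_word :: "'e seg list \<Rightarrow> 'e seg list" where
  "rev_word w = rev (map rev_seg w)"

definition seg_start :: "('a::topological_space, 'e) nielsen_complex \<Rightarrow> 'e seg \<Rightarrow> 'a" where
  "seg_start G s = edge_map G (fst s) (fst (snd s))"

definition seg_end :: "('a::topological_space, 'e) nielsen_complex \<Rightarrow> 'e seg \<Rightarrow> 'a" where
  "seg_end G s = edge_map G (fst s) (snd (snd s))"

definition full_seg :: "'e seg \<Rightarrow> bool" where
  "full_seg s \<longleftrightarrow> snd s = (0, 1) \<or> snd s = (1, 0)"

definition full_word :: "'e seg list \<Rightarrow> bool" where
  "full_word w \<longleftrightarrow> (\<forall>s\<in>set w. full_seg s)"

definition valid_seg :: "('a, 'e) nielsen_complex \<Rightarrow> 'e seg \<Rightarrow> bool" where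
  "valid_seg G s \<longleftrightarrow>
     (fst s \<in> hat G \<and> fst (snd s) \<in> {0..1} \<and> snd (snd s) \<in> {0..1} \<and> fst (snd s) \<noteq> snd (snd s)) \<or>
     (fst s \<in> gam G \<union> aux G \<and> full_seg s)"

definition joined :: "('a::topological_space, 'e) nielsen_complex \<Rightarrow> 'e seg list \<Rightarrow> bool" where
  "joined G w \<longleftrightarrow> (\<forall>i. Suc i < length w \<longrightarrow>
     snd (snd (w ! i)) \<in> {0, 1} \<and> fst (snd (w ! Suc i)) \<in> {0, 1} \<and>
     seg_end G (w ! i) = seg_start G (w ! Suc i))"

definition backtrack :: "'e seg \<Rightarrow> 'e seg \<Rightarrow> bool" where
  "backtrack s t \<longleftrightarrow> fst s = fst t \<and> snd (snd s) = fst (snd t)"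

text \<open>Rewriting auxiliary edges in terms of half-edges; reducedness is meant in the graph whose edges
  are the cells, so that it is tested after this rewriting.\<close>

definition seg_cells :: "('a, 'e) nielsen_complex \<Rightarrow> 'e seg \<Rightarrow> 'e seg list" where
  "seg_cells G s =
     (if fst s \<in> aux G
      then (if fst (snd s) < snd (snd s)
            then [(fst (legs G (fst s)), 0, 1), (snd (legs G (fst s)), 1, 0)]
            else [(snd (legs G (fst s)), 0, 1), (fst (legs G (fst s)), 1, 0)])
      else [s])"

definition word_cells :: "('a, 'e) nielsen_complex \<Rightarrow> 'e seg list \<Rightarrow> 'e seg list" where
  "word_cells G w = concat (map (seg_cells G) w)"

definition reduced_word :: "('a, 'e) nielsen_complex \<Rightarrow> 'e seg list \<Rightarrow> bool" where
  "reduced_word G w \<longleftrightarrow> (let c = word_cells G w in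
     \<forall>i. Suc i < length c \<longrightarrow> \<not> backtrack (c ! i) (c ! Suc i))"

definition rel_part_reduced :: "('a, 'e) nielsen_complex \<Rightarrow> 'e seg list \<Rightarrow> bool" where
  "rel_part_reduced G w \<longleftrightarrow> (let c = word_cells G w in
     \<forall>i. Suc i < length c \<longrightarrow> fst (c ! i) \<notin> hat G \<longrightarrow> \<not> backtrack (c ! i) (c ! Suc i))"

text \<open>Possible endpoints of paths: vertices other than the auxiliary ones (these are interior to
  auxiliary edges), and interior points of edges in the train track part.\<close>

definition endpoints :: "('a, 'e) nielsen_complex \<Rightarrow> 'a set" where
  "endpoints G = verts G \<union> (\<Union>e\<in>hat G. open_edge G e)"

fun track :: "('a::topological_space, 'e) nielsen_complex \<Rightarrow> 'a \<Rightarrow> 'e seg list \<Rightarrow> real \<Rightarrow> 'a" where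
  "track G x [] = (\<lambda>_. x)"
| "track G x (s # w) =
     sub_path (fst (snd s)) (snd (snd s)) (edge_map G (fst s)) +++ track G (seg_end G s) w"

definition realize :: "('a::topological_space, 'e) nielsen_complex \<Rightarrow> ('a, 'e) edge_path \<Rightarrow> real \<Rightarrow> 'a" where
  "realize G \<gamma> = track G (fst \<gamma>) (snd \<gamma>)"

text \<open>Paths in the 1-skeleton. Only the first and the last segment can be partial, since the others
  begin and end at vertices and are non-trivial without turning inside an edge.\<close>

definition is_path :: "('a::topological_space, 'e) nielsen_complex \<Rightarrow> ('a, 'e) edge_path \<Rightarrow> bool" where
  "is_path G \<gamma> \<longleftrightarrow>
     fst \<gamma> \<in> endpoints G \<and>
     (snd \<gamma> \<noteq> [] \<longrightarrow> fst \<gamma> = seg_start G (hd (snd \<gamma>))) \<and>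
     (\<forall>s\<in>set (snd \<gamma>). valid_seg G s) \<and>
     joined G (snd \<gamma>) \<and> rel_part_reduced G (snd \<gamma>)"

definition word_path :: "('a::topological_space, 'e) nielsen_complex \<Rightarrow> 'e seg list \<Rightarrow> ('a, 'e) edge_path" where
  "word_path G w = (seg_start G (hd w), w)"

definition in_Gamma :: "('a, 'e) nielsen_complex \<Rightarrow> 'e seg list \<Rightarrow> bool" where
  "in_Gamma G w \<longleftrightarrow> (\<forall>s\<in>set w. fst s \<in> hat G \<union> gam G)"

definition subword :: "nat \<Rightarrow> nat \<Rightarrow> 'b list \<Rightarrow> 'b list" where
  "subword i j w = drop i (take j w)"

section \<open>Legal paths, INPs, strongly legal paths\<close>

text \<open>These notions make sense for arbitrary continuous paths, which is how they are applied to
  \<open>f ^^ t \<circ> \<gamma>\<close>.\<close>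

definition rel_backtracking :: "('a::topological_space, 'e) nielsen_complex \<Rightarrow> (real \<Rightarrow> 'a) \<Rightarrow> bool" where
  "rel_backtracking G p \<longleftrightarrow> (\<exists>q. homotopic_paths (G2 G) p q \<and> path_image q \<subseteq> rel_part G)"

definition rel_reduced :: "('a::topological_space, 'e) nielsen_complex \<Rightarrow> (real \<Rightarrow> 'a) \<Rightarrow> bool" where
  "rel_reduced G p \<longleftrightarrow>
     (\<forall>u v. 0 \<le> u \<and> u \<le> v \<and> v \<le> 1 \<and> rel_backtracking G (sub_path u v p) \<longrightarrow>
        path_image (sub_path u v p) \<subseteq> rel_part G)"

definition legal :: "('a::topological_space, 'e) nielsen_complex \<Rightarrow> ('a \<Rightarrow> 'a) \<Rightarrow> (real \<Rightarrow> 'a) \<Rightarrow> bool" where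
  "legal G f p \<longleftrightarrow> (\<forall>t\<ge>1. rel_reduced G ((f ^^ t) \<circ> p))"

text \<open>For a loop, subpaths may pass through the base point.\<close>

definition legal_loop :: "('a::topological_space, 'e) nielsen_complex \<Rightarrow> ('a \<Rightarrow> 'a) \<Rightarrow> (real \<Rightarrow> 'a) \<Rightarrow> bool" where
  "legal_loop G f p \<longleftrightarrow> (\<forall>a\<in>{0..1}. legal G f (shiftpath a p))"

definition legal_word :: "('a::topological_space, 'e) nielsen_complex \<Rightarrow> ('a \<Rightarrow> 'a) \<Rightarrow> 'e seg list \<Rightarrow> bool" where
  "legal_word G f w \<longleftrightarrow> legal G f (realize G (word_path G w))"

definition expanding :: "('a::topological_space, 'e) nielsen_complex \<Rightarrow> ('a \<Rightarrow> 'a) \<Rightarrow> 'e \<Rightarrow> bool" where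
  "expanding G f e \<longleftrightarrow>
     (\<exists>t\<ge>1. \<exists>\<delta>. is_path G \<delta> \<and> full_word (snd \<delta>) \<and>
        equiv_mod (rel_part G) ((f ^^ t) \<circ> emap G e) (realize G \<delta>) \<and>
        2 \<le> length (filter (\<lambda>s. fst s \<in> hat G) (snd \<delta>)))"

definition INP_break :: "('a::topological_space, 'e) nielsen_complex \<Rightarrow> ('a \<Rightarrow> 'a) \<Rightarrow> 'e seg list \<Rightarrow> nat \<Rightarrow> bool" where
  "INP_break G f w k \<longleftrightarrow> 0 < k \<and> k < length w \<and> legal_word G f (take k w) \<and> legal_word G f (drop k w)"

definition INP :: "('a::topological_space, 'e) nielsen_complex \<Rightarrow> ('a \<Rightarrow> 'a) \<Rightarrow> 'e seg list \<Rightarrow> bool" where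
  "INP G f w \<longleftrightarrow> w \<noteq> [] \<and> is_path G (word_path G w) \<and> reduced_word G w \<and>
     fst (hd w) \<in> hat G \<and> fst (last w) \<in> hat G \<and>
     (\<exists>k. INP_break G f w k) \<and>
     (\<forall>t. \<not> legal G f ((f ^^ t) \<circ> realize G (word_path G w))) \<and>
     (\<exists>t\<ge>1. homotopic_paths (G1 G) ((f ^^ t) \<circ> realize G (word_path G w)) (realize G (word_path G w)))"

text \<open>A turn of \<open>w\<close> is given by the positions of two successive segments of the train
  track part. Between them there is an edge path in the relative part.\<close>

definition turn :: "('a, 'e) nielsen_complex \<Rightarrow> 'e seg list \<Rightarrow> nat \<times> nat \<Rightarrow> bool" where
  "turn G w = (\<lambda>(i, j). i < j \<and> j < length w \<and> fst (w ! i) \<in> hat G \<and> fst (w ! j) \<in> hat G \<and>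
     (\<forall>k. i < k \<and> k < j \<longrightarrow> fst (w ! k) \<notin> hat G))"

definition legal_turn :: "('a::topological_space, 'e) nielsen_complex \<Rightarrow> ('a \<Rightarrow> 'a) \<Rightarrow> 'e seg list \<Rightarrow> nat \<times> nat \<Rightarrow> bool" where
  "legal_turn G f w = (\<lambda>(i, j). legal_word G f (subword i (Suc j) w))"

definition tip :: "('a::topological_space, 'e) nielsen_complex \<Rightarrow> ('a \<Rightarrow> 'a) \<Rightarrow> 'e seg list \<Rightarrow> nat \<times> nat \<Rightarrow> bool" where
  "tip G f w = (\<lambda>(i, j). turn G w (i, j) \<and> (\<exists>k. INP_break G f w k \<and> i < k \<and> k \<le> j))"

definition rhat_seg :: "('a, 'e) nielsen_complex \<Rightarrow> 'e seg \<Rightarrow> 'e seg list" where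
  "rhat_seg G s =
     (if fst s \<in> aux G
      then (if fst (snd s) < snd (snd s) then inp G (fst s) else rev_word (inp G (fst s)))
      else [s])"

definition rhat_word :: "('a, 'e) nielsen_complex \<Rightarrow> 'e seg list \<Rightarrow> 'e seg list" where
  "rhat_word G w = concat (map (rhat_seg G) w)"

definition strongly_legal :: "('a::topological_space, 'e) nielsen_complex \<Rightarrow> ('a \<Rightarrow> 'a) \<Rightarrow> ('a, 'e) edge_path \<Rightarrow> bool" where
  "strongly_legal G f \<gamma> \<longleftrightarrow> legal G f (realize G \<gamma>) \<and>
     (let w = snd \<gamma> in
      \<forall>i j. turn G (rhat_word G w) (i, j) \<and> \<not> legal_turn G f (rhat_word G w) (i, j) \<longrightarrow>
        (\<exists>k<length w. \<exists>i' j'. fst (w ! k) \<in> aux G \<and> tip G f (rhat_seg G (w ! k)) (i', j') \<and>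
           i = length (rhat_word G (take k w)) + i' \<and> j = length (rhat_word G (take k w)) + j'))"

text \<open>The turns of \<open>w\<close> that are not legal or have a maximal sub-half-turn that is not strongly
  legal (there is no sub-half-turn if the path in the relative part is trivial).\<close>

definition illegal_turns :: "('a::topological_space, 'e) nielsen_complex \<Rightarrow> ('a \<Rightarrow> 'a) \<Rightarrow> 'e seg list \<Rightarrow> (nat \<times> nat) set" where
  "illegal_turns G f w = {(i, j). turn G w (i, j) \<and>
     (\<not> legal_turn G f w (i, j) \<or>
      (Suc i < j \<and> (\<not> strongly_legal G f (word_path G (subword i j w)) \<or>
                    \<not> strongly_legal G f (word_path G (subword (Suc i) (Suc j) w)))))}"

section \<open>Nielsen faces and the retraction\<close>

definition nielsen_face :: "('a::topological_space, 'e) nielsen_complex \<Rightarrow> 'e \<Rightarrow> bool" where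
  "nielsen_face G e \<longleftrightarrow> (\<exists>\<Phi>\<in>faces G. \<exists>a. same_up_to_param (\<lambda>t. \<Phi> (cis (2 * pi * t + a)))
     (realize G (word_path G ((e, 1, 0) # inp G e))))"

definition edge_center :: "('a, 'e) nielsen_complex \<Rightarrow> 'e \<Rightarrow> 'a" where
  "edge_center G e = emap G (fst (legs G e)) 1"

text \<open>Among auxiliary edges with a common central vertex, some Nielsen faces are redundant: the three
  faces at a tripod would produce an essential 2-sphere, which contradicts the retraction to \<open>\<Gamma>\<close> being
  a homotopy equivalence. There the face may be missing, provided that the auxiliary edge is homotopic
  to its INP all the same.\<close>

definition nielsen_faces :: "('a::topological_space, 'e) nielsen_complex \<Rightarrow> ('a \<Rightarrow> 'a) \<Rightarrow> bool" where
  "nielsen_faces G f \<longleftrightarrow>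
     finite {w. INP G f w} \<and>
     (\<forall>w. INP G f w \<longrightarrow> (\<exists>e\<in>aux G. w = inp G e \<or> w = rev_word (inp G e))) \<and>
     (\<forall>e\<in>aux G. INP G f (inp G e) \<and>
        seg_start G (hd (inp G e)) = edge_map G e 0 \<and> seg_end G (last (inp G e)) = edge_map G e 1 \<and>
        (nielsen_face G e \<or>
         (\<exists>e'\<in>aux G. e' \<noteq> e \<and> edge_center G e' = edge_center G e) \<and>
         homotopic_paths (G2 G) (edge_map G e) (realize G (word_path G (inp G e)))))"

definition cancel_seg :: "'e seg \<Rightarrow> 'e seg list \<Rightarrow> 'e seg list" where
  "cancel_seg s w = (case w of [] \<Rightarrow> [s] | t # w' \<Rightarrow> if t = rev_seg s then w' else s # w)"

definition free_reduce :: "'e seg list \<Rightarrow> 'e seg list" where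
  "free_reduce w = foldr cancel_seg w []"

text \<open>The pre-INP \<open>r(e)\<close>.\<close>

definition pre_INP :: "('a, 'e) nielsen_complex \<Rightarrow> 'e \<Rightarrow> 'e seg list" where
  "pre_INP G e = free_reduce ((rhat_word G ^^ rpow G) [(e, 0, 1)])"

definition ret_seg :: "('a, 'e) nielsen_complex \<Rightarrow> 'e seg \<Rightarrow> 'e seg list" where
  "ret_seg G s =
     (if fst s \<in> aux G
      then (if fst (snd s) < snd (snd s) then pre_INP G (fst s) else rev_word (pre_INP G (fst s)))
      else [s])"

definition ret_word :: "('a, 'e) nielsen_complex \<Rightarrow> 'e seg list \<Rightarrow> 'e seg list" where
  "ret_word G w = concat (map (ret_seg G) w)"

definition retraction_structure :: "('a::topological_space, 'e) nielsen_complex \<Rightarrow> bool" where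
  "retraction_structure G \<longleftrightarrow>
     continuous_on (G1 G) (rhat G) \<and> rhat G ` G1 G \<subseteq> G1 G \<and> (\<forall>x\<in>Gamma G. rhat G x = x) \<and>
     (\<forall>e\<in>aux G. equiv_mod (rel_part G) (rhat G \<circ> edge_map G e) (realize G (word_path G (inp G e)))) \<and>
     (\<forall>e\<in>aux G. in_Gamma G ((rhat_word G ^^ rpow G) [(e, 0, 1)])) \<and>
     (\<forall>x\<in>G1 G. ret G x = (rhat G ^^ rpow G) x) \<and>
     continuous_on (G2 G) (ret G) \<and> ret G ` G2 G \<subseteq> Gamma G \<and> (\<forall>x\<in>Gamma G. ret G x = x)"

section \<open>Partial train track maps with Nielsen faces\<close>

text \<open>That \<open>f\<close> sends edges to edge paths (in particular vertices that are not auxiliary to such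
  vertices) is implicit in the notion of the image path \<open>f(\<gamma>)\<close>. The legal path or loop \<open>q\<close> in the last
  two conditions is an arbitrary continuous one, because the endpoints of \<open>f ^^ t \<circ> \<gamma>\<close> may lie
  inside an edge of the relative part when \<open>\<gamma>\<close> has partially traversed edges.\<close>

definition partial_train_track_map :: "('a::t2_space, 'e) nielsen_complex \<Rightarrow> ('a \<Rightarrow> 'a) \<Rightarrow> bool" where
  "partial_train_track_map G f \<longleftrightarrow>
     cell_complex G \<and> auxiliary_structure G \<and> nielsen_faces G f \<and> retraction_structure G \<and>
     continuous_on (G2 G) f \<and> f ` G2 G \<subseteq> G2 G \<and> f ` rel_part G \<subseteq> rel_part G \<and> f ` G1 G \<subseteq> G1 G \<and>
     (\<forall>e\<in>hat G \<union> gam G \<union> aux G. \<exists>\<delta>. is_path G \<delta> \<and> full_word (snd \<delta>) \<and>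
        equiv_mod (rel_part G) (f \<circ> edge_map G e) (realize G \<delta>)) \<and>
     (\<forall>e\<in>hat G. legal G f (emap G e)) \<and>
     (\<forall>e\<in>hat G. expanding G f e) \<and>
     (\<forall>\<gamma>. is_path G \<gamma> \<longrightarrow> (\<exists>t q. path q \<and> path_image q \<subseteq> G1 G \<and> legal G f q \<and>
        homotopic_paths (G2 G) ((f ^^ t) \<circ> realize G \<gamma>) q)) \<and>
     (\<forall>\<gamma>. is_path G \<gamma> \<and> pathfinish (realize G \<gamma>) = pathstart (realize G \<gamma>) \<longrightarrow>
        (\<exists>t q. path q \<and> pathfinish q = pathstart q \<and> path_image q \<subseteq> G1 G \<and> legal_loop G f q \<and>
           homotopic_loops (G2 G) ((f ^^ t) \<circ> realize G \<gamma>) q))"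

section \<open>Relative train track maps in the sense of Bestvina and Handel\<close>

definition edge_image :: "('e \<Rightarrow> 'e seg list) \<Rightarrow> 'e seg \<Rightarrow> 'e seg list" where
  "edge_image g s = (if fst (snd s) < snd (snd s) then g (fst s) else rev_word (g (fst s)))"

definition word_image :: "('e \<Rightarrow> 'e seg list) \<Rightarrow> 'e seg list \<Rightarrow> 'e seg list" where
  "word_image g w = concat (map (edge_image g) w)"

definition direction_map :: "('e \<Rightarrow> 'e seg list) \<Rightarrow> 'e seg \<Rightarrow> 'e seg" where
  "direction_map g s = hd (edge_image g s)"

text \<open>The turn of an edge path at the vertex between \<open>s\<close> and \<open>t\<close> consists of the directions
  \<open>rev_seg s\<close> and \<open>t\<close>.\<close>

definition degenerate_eventually :: "('e \<Rightarrow> 'e seg list) \<Rightarrow> 'e seg \<Rightarrow> 'e seg \<Rightarrow> bool" where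
  "degenerate_eventually g s t \<longleftrightarrow>
     (\<exists>k. (direction_map g ^^ k) (rev_seg s) = (direction_map g ^^ k) t)"

definition transition :: "('e \<Rightarrow> 'e seg list) \<Rightarrow> 'e \<Rightarrow> 'e \<Rightarrow> nat" where
  "transition g e e' = length (filter (\<lambda>s. fst s = e) (g e'))"

primrec transition_power :: "('e \<Rightarrow> 'e seg list) \<Rightarrow> 'e set \<Rightarrow> nat \<Rightarrow> 'e \<Rightarrow> 'e \<Rightarrow> nat" where
  "transition_power g H 0 e e' = (if e = e' then 1 else 0)"
| "transition_power g H (Suc k) e e' = (\<Sum>c\<in>H. transition g e c * transition_power g H k c e')"

definition irreducible_stratum :: "('e \<Rightarrow> 'e seg list) \<Rightarrow> 'e set \<Rightarrow> bool" where
  "irreducible_stratum g H \<longleftrightarrow> (\<forall>e\<in>H. \<forall>e'\<in>H. \<exists>k\<ge>1. transition_power g H k e e' > 0)"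

definition zero_stratum :: "('e \<Rightarrow> 'e seg list) \<Rightarrow> 'e set \<Rightarrow> bool" where
  "zero_stratum g H \<longleftrightarrow> (\<forall>e\<in>H. \<forall>e'\<in>H. transition g e e' = 0)"

text \<open>The Perron-Frobenius eigenvalue, i.e. the eigenvalue with a positive eigenvector, exceeds 1.\<close>

definition exponential_stratum :: "('e \<Rightarrow> 'e seg list) \<Rightarrow> 'e set \<Rightarrow> bool" where
  "exponential_stratum g H \<longleftrightarrow> irreducible_stratum g H \<and>
     (\<exists>(\<mu>::real) v. \<mu> > 1 \<and> (\<forall>e\<in>H. v e > 0) \<and>
        (\<forall>e\<in>H. (\<Sum>e'\<in>H. real (transition g e e') * v e') = \<mu> * v e))"

definition edge_ends :: "('a, 'e) nielsen_complex \<Rightarrow> 'e set \<Rightarrow> 'a set" where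
  "edge_ends G E = (\<Union>e\<in>E. {emap G e 0, emap G e 1})"

definition Gamma_word :: "('a::topological_space, 'e) nielsen_complex \<Rightarrow> 'e set \<Rightarrow> 'e seg list \<Rightarrow> bool" where
  "Gamma_word G E w \<longleftrightarrow> full_word w \<and> fst ` set w \<subseteq> E \<and> joined G w \<and> reduced_word G w"

text \<open>The conditions of Bestvina and Handel on an exponentially growing stratum \<open>H\<close> lying over the
  subgraph with edges \<open>L\<close>.\<close>

definition RTT :: "('a::topological_space, 'e) nielsen_complex \<Rightarrow> ('e \<Rightarrow> 'e seg list) \<Rightarrow> 'e set \<Rightarrow> 'e set \<Rightarrow> bool" where
  "RTT G g L H \<longleftrightarrow>
     (\<forall>e\<in>H. fst (direction_map g (e, 0, 1)) \<in> H \<and> fst (direction_map g (e, 1, 0)) \<in> H) \<and>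
     (\<forall>w. w \<noteq> [] \<and> Gamma_word G L w \<and>
          seg_start G (hd w) \<in> edge_ends G H \<and> seg_end G (last w) \<in> edge_ends G H \<longrightarrow>
        (let w' = free_reduce (word_image g w) in w' \<noteq> [] \<and>
          seg_start G (hd w') \<in> edge_ends G H \<inter> edge_ends G L \<and>
          seg_end G (last w') \<in> edge_ends G H \<inter> edge_ends G L)) \<and>
     (\<forall>w. Gamma_word G H w \<and>
          (\<forall>i. Suc i < length w \<longrightarrow> \<not> degenerate_eventually g (w ! i) (w ! Suc i)) \<longrightarrow>
        (let w' = word_image g w in \<forall>i. Suc i < length w' \<and> fst (w' ! i) \<in> H \<and> fst (w' ! Suc i) \<in> H
           \<longrightarrow> \<not> degenerate_eventually g (w' ! i) (w' ! Suc i)))"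

text \<open>Edge images are read after tightening relative to endpoints: \<open>g e\<close> is the reduced edge path
  of the image of \<open>e\<close>. The filtration is given by the edge sets \<open>lev i\<close> of its subgraphs.\<close>

definition relative_train_track_map :: "('a::topological_space, 'e) nielsen_complex \<Rightarrow> ('a \<Rightarrow> 'a) \<Rightarrow> bool" where
  "relative_train_track_map G h \<longleftrightarrow>
     is_homotopy_equivalence (Gamma G) (Gamma G) h \<and> h ` verts G \<subseteq> verts G \<and>
     (\<exists>g m lev.
        (\<forall>e\<in>hat G \<union> gam G. g e \<noteq> [] \<and> Gamma_word G (hat G \<union> gam G) (g e) \<and>
           homotopic_paths (Gamma G) (h \<circ> emap G e) (realize G (word_path G (g e)))) \<and>
        lev 0 = {} \<and> lev (m::nat) = hat G \<union> gam G \<and>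
        (\<forall>i<m. lev i \<subset> lev (Suc i)) \<and>
        (\<forall>i\<le>m. \<forall>e\<in>lev i. fst ` set (g e) \<subseteq> lev i) \<and>
        (\<forall>i<m. let H = lev (Suc i) - lev i in
           (zero_stratum g H \<or> irreducible_stratum g H) \<and>
           (exponential_stratum g H \<longrightarrow> RTT G g (lev i) H)))"

section \<open>Quasi-geodesics in the universal covering\<close>

text \<open>Points of the universal covering of the complex are homotopy classes of paths issuing from the
  base point. The metric is the simplicial one on the 1-skeleton of the covering: it is the length
  metric in which every edge (auxiliary edges included) has length 1.\<close>

definition covering_points :: "('a::topological_space, 'e) nielsen_complex \<Rightarrow> 'a \<Rightarrow> 'a \<Rightarrow> (real \<Rightarrow> 'a) set set" where
  "covering_points G b x = path_class (G2 G) `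
     {p. path p \<and> path_image p \<subseteq> G2 G \<and> pathstart p = b \<and> pathfinish p = x}"

text \<open>Endpoint of the lift of \<open>\<gamma>\<close> that starts at the point \<open>P\<close> of the covering.\<close>

definition lift_end :: "('a::topological_space, 'e) nielsen_complex \<Rightarrow> (real \<Rightarrow> 'a) set \<Rightarrow> ('a, 'e) edge_path \<Rightarrow> (real \<Rightarrow> 'a) set" where
  "lift_end G P \<gamma> = {q. \<exists>p\<in>P. homotopic_paths (G2 G) (p +++ realize G \<gamma>) q}"

definition simplicial_length :: "'e seg list \<Rightarrow> real" where
  "simplicial_length w = (\<Sum>s\<leftarrow>w. \<bar>snd (snd s) - fst (snd s)\<bar>)"

definition covering_dist :: "('a::topological_space, 'e) nielsen_complex \<Rightarrow> (real \<Rightarrow> 'a) set \<Rightarrow> (real \<Rightarrow> 'a) set \<Rightarrow> real" where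
  "covering_dist G P Q = Inf {simplicial_length (snd \<delta>) | \<delta>. is_path G \<delta> \<and>
     (\<forall>p\<in>P. pathfinish p = fst \<delta>) \<and> lift_end G P \<delta> = Q}"

text \<open>Every lift of \<open>\<gamma>\<close> is a quasi-geodesic; it suffices to compare length and distance between
  the breakpoints of \<open>\<gamma>\<close>, which are at distance at most 1 from each other.\<close>

definition quasi_geodesic_lifts :: "('a::topological_space, 'e) nielsen_complex \<Rightarrow> 'a \<Rightarrow> real \<Rightarrow> real \<Rightarrow> ('a, 'e) edge_path \<Rightarrow> bool" where
  "quasi_geodesic_lifts G b \<mu> C \<gamma> \<longleftrightarrow>
     (\<forall>P\<in>covering_points G b (fst \<gamma>). \<forall>i j. i \<le> j \<and> j \<le> length (snd \<gamma>) \<longrightarrow>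
        (let d = covering_dist G (lift_end G P (fst \<gamma>, take i (snd \<gamma>)))
                                 (lift_end G P (fst \<gamma>, take j (snd \<gamma>)));
             l = simplicial_length (subword i j (snd \<gamma>))
         in l / \<mu> - C \<le> d \<and> d \<le> \<mu> * l + C))"

text \<open>\<open>v\<close> arises from \<open>w\<close> by applying \<open>r\<close> to some subpaths. As \<open>r\<close> is the identity on
  \<open>\<Gamma>\<close>, this amounts to applying it to some of the segments.\<close>

definition partially_retracted :: "('a, 'e) nielsen_complex \<Rightarrow> 'e seg list \<Rightarrow> 'e seg list \<Rightarrow> bool" where
  "partially_retracted G w v \<longleftrightarrow>
     (\<exists>K. v = concat (map (\<lambda>k. if k \<in> K then ret_seg G (w ! k) else [w ! k]) [0..<length w]))"

section \<open>\<open>\<beta>\<close>-train track maps\<close>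

text \<open>\<open>\<theta>\<close> is the marking isomorphism. The outer automorphism induced by \<open>f\<close> is represented by
  \<open>[p] \<mapsto> [\<sigma> \<cdot> f(p) \<cdot> \<sigma>\<inverse>]\<close> for a path \<open>\<sigma>\<close> from the base point to its image.\<close>

definition represents ::
    "('a::topological_space, 'e) nielsen_complex \<Rightarrow> ('a \<Rightarrow> 'a) \<Rightarrow> ('g, 'm) monoid_scheme \<Rightarrow> ('g \<Rightarrow> 'g) \<Rightarrow>
     'a \<Rightarrow> ((real \<Rightarrow> 'a) set \<Rightarrow> 'g) \<Rightarrow> bool" where
  "represents G f F \<alpha> b \<theta> \<longleftrightarrow>
     b \<in> G2 G \<and> \<theta> \<in> iso (fundamental_group (G2 G) b) F \<and>
     (\<exists>\<sigma> c. path \<sigma> \<and> path_image \<sigma> \<subseteq> G2 G \<and> pathstart \<sigma> = b \<and> pathfinish \<sigma> = f b \<and> c \<in> carrier F \<and>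
        (\<forall>p\<in>loops_at (G2 G) b.
           \<theta> (path_class (G2 G) (\<sigma> +++ (f \<circ> p) +++ reversepath \<sigma>)) =
           c \<otimes>\<^bsub>F\<^esub> \<alpha> (\<theta> (path_class (G2 G) p)) \<otimes>\<^bsub>F\<^esub> inv\<^bsub>F\<^esub> c))"

text \<open>The vertex spaces \<open>X\<^sub>v\<close> are the components of the relative part, and a loop in
  \<open>X\<^sub>v\<close> is connected to the base point of the marking by a path \<open>\<sigma>\<close>.\<close>

definition vertex_space_condition ::
    "('a::topological_space, 'e) nielsen_complex \<Rightarrow> ('g, 'm) monoid_scheme \<Rightarrow> 'g set \<Rightarrow> ('g \<Rightarrow> 'g) \<Rightarrow>
     'a \<Rightarrow> ((real \<Rightarrow> 'a) set \<Rightarrow> 'g) \<Rightarrow> bool" where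
  "vertex_space_condition G F B \<alpha> b \<theta> \<longleftrightarrow>
     (\<forall>V\<in>components (rel_part G). \<forall>x\<in>V. \<forall>\<sigma>.
        path \<sigma> \<and> path_image \<sigma> \<subseteq> G2 G \<and> pathstart \<sigma> = b \<and> pathfinish \<sigma> = x \<longrightarrow>
        (\<forall>p\<in>loops_at V x. \<forall>q\<in>loops_at V x.
           \<theta> (path_class (G2 G) (\<sigma> +++ p +++ reversepath \<sigma>)) =
           \<theta> (path_class (G2 G) (\<sigma> +++ q +++ reversepath \<sigma>)) \<longrightarrow> homotopic_paths V p q) \<and>
        (\<forall>p\<in>loops_at V x.
           polynomial_growth F B \<alpha> (\<theta> (path_class (G2 G) (\<sigma> +++ p +++ reversepath \<sigma>)))))"

text \<open>In the last condition \<open>f ^^ t \<circ> \<gamma>\<close> has to be a path in the 1-skeleton in the above sense, i.e.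
  its endpoints must not be interior to edges of the relative part. In the condition that \<open>f\<close>
  preserves strong legality, \<open>\<delta>\<close> is the path \<open>f(\<gamma>)\<close>.\<close>

definition beta_train_track_map ::
    "('a::t2_space, 'e) nielsen_complex \<Rightarrow> ('a \<Rightarrow> 'a) \<Rightarrow> ('g, 'm) monoid_scheme \<Rightarrow> 'g set \<Rightarrow> ('g \<Rightarrow> 'g) \<Rightarrow>
     'a \<Rightarrow> ((real \<Rightarrow> 'a) set \<Rightarrow> 'g) \<Rightarrow> bool" where
  "beta_train_track_map G f F B \<alpha> b \<theta> \<longleftrightarrow>
     partial_train_track_map G f \<and> represents G f F \<alpha> b \<theta> \<and>
     vertex_space_condition G F B \<alpha> b \<theta> \<and>
     is_homotopy_equivalence (G2 G) (Gamma G) (ret G) \<and>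
     relative_train_track_map G (ret G \<circ> f) \<and>
     (\<forall>e\<in>hat G. strongly_legal G f (word_path G [(e, 0, 1)])) \<and>
     (\<forall>\<gamma> \<delta>. is_path G \<gamma> \<and> strongly_legal G f \<gamma> \<and> is_path G \<delta> \<and>
        equiv_mod (rel_part G) (f \<circ> realize G \<gamma>) (realize G \<delta>) \<longrightarrow> strongly_legal G f \<delta>) \<and>
     (\<forall>e\<in>hat G. expanding G f e) \<and>
     (\<exists>\<mu>\<ge>1. \<exists>C\<ge>0. \<forall>\<gamma>. is_path G \<gamma> \<and> strongly_legal G f \<gamma> \<longrightarrow> quasi_geodesic_lifts G b \<mu> C \<gamma>) \<and>
     (\<exists>\<mu>\<ge>1. \<exists>C\<ge>0.
        (\<forall>\<gamma>. is_path G \<gamma> \<and> in_Gamma G (snd \<gamma>) \<and> reduced_word G (snd \<gamma>) \<longrightarrow>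
           quasi_geodesic_lifts G b \<mu> C \<gamma>) \<and>
        (\<forall>\<gamma>. is_path G \<gamma> \<and> reduced_word G (ret_word G (snd \<gamma>)) \<longrightarrow>
           quasi_geodesic_lifts G b \<mu> C \<gamma>) \<and>
        (\<forall>\<gamma> v \<delta>. is_path G \<gamma> \<and> strongly_legal G f \<gamma> \<and> partially_retracted G (snd \<gamma>) v \<and>
           is_path G \<delta> \<and> equiv_mod (rel_part G) (realize G (fst \<gamma>, v)) (realize G \<delta>) \<longrightarrow>
           quasi_geodesic_lifts G b \<mu> C \<delta>)) \<and>
     (\<exists>T::nat \<Rightarrow> nat. \<forall>\<gamma>. is_path G \<gamma> \<longrightarrow>
        (let q = (f ^^ T (card (illegal_turns G f (snd \<gamma>)))) \<circ> realize G \<gamma> in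
         pathstart q \<in> endpoints G \<and> pathfinish q \<in> endpoints G \<longrightarrow>
         (\<exists>\<delta>. is_path G \<delta> \<and> strongly_legal G f \<delta> \<and> homotopic_paths (G2 G) q (realize G \<delta>))))"

section \<open>Normalized paths\<close>

text \<open>\<open>(i, s)\<close> is an occurrence in \<open>w\<close>, starting at position \<open>i\<close>, of the pre-INP of the
  auxiliary edge \<open>s\<close>, taken in either orientation.\<close>

definition pre_INP_occurrence :: "('a, 'e) nielsen_complex \<Rightarrow> 'e seg list \<Rightarrow> nat \<times> 'e seg \<Rightarrow> bool" where
  "pre_INP_occurrence G w = (\<lambda>(i, s). fst s \<in> aux G \<and> full_seg s \<and>
     i + length (ret_seg G s) \<le> length w \<and> subword i (i + length (ret_seg G s)) w = ret_seg G s)"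

definition isolated_pre_INP :: "('a, 'e) nielsen_complex \<Rightarrow> 'e seg list \<Rightarrow> nat \<times> 'e seg \<Rightarrow> bool" where
  "isolated_pre_INP G w = (\<lambda>(i, s). pre_INP_occurrence G w (i, s) \<and>
     (\<forall>i' s'. pre_INP_occurrence G w (i', s') \<and>
        {i..<i + length (ret_seg G s)} \<inter> {i'..<i' + length (ret_seg G s')} \<noteq> {} \<longrightarrow>
        {i'..<i' + length (ret_seg G s')} \<subseteq> {i..<i + length (ret_seg G s)}))"

text \<open>The word \<open>w\<close> of a path is obtained from \<open>ret_word G w\<close> by replacing pre-INPs by auxiliary
  edges; the segment \<open>w ! k\<close> replaces the pre-INP at position \<open>length (ret_word G (take k w))\<close>. The
  second condition says that the pre-INPs replaced are exactly the isolated ones.\<close>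

definition normalized :: "('a::topological_space, 'e) nielsen_complex \<Rightarrow> ('a, 'e) edge_path \<Rightarrow> bool" where
  "normalized G \<gamma> \<longleftrightarrow> is_path G \<gamma> \<and>
     (let w = snd \<gamma> in
      reduced_word G (ret_word G w) \<and>
      {(length (ret_word G (take k w)), w ! k) | k. k < length w \<and> fst (w ! k) \<in> aux G} =
      {(i, s). isolated_pre_INP G (ret_word G w) (i, s)})"

end

theory Submission
  imports Defs "HOL-Complex_Analysis.Winding_Numbers"
begin

text \<open>The proof compares a path with its image in \<open>\<Gamma>\<close>. Pushing each auxiliary edge across its Nielsen face, and
  iterating, shows that a path is homotopic in \<open>\<G>\<^sup>2\<close> to the word obtained by replacing every auxiliary edge by
  its pre-INP (\<open>ret_word_homotopic\<close>); tightening that word gives a reduced word \<open>W\<close> in \<open>\<Gamma>\<close>.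

  The word \<open>W\<close> is determined by the homotopy class (\<open>tight_unique\<close>). Two different reduced words would give a
  non-trivial reduced null-homotopic loop. A null-homotopic loop that is also cyclically reduced has powers which
  are reduced, hence lift to quasi-geodesics with fixed constants, whereas the lifts return to their starting
  point although their lengths tend to infinity. Every other loop is conjugate to a shorter one. Since a
  normalized path is recovered from its retraction and the positions of its auxiliary edges, which are those of
  the isolated pre-INPs, this is uniqueness (\<open>normalized_unique\<close>).

  For existence every isolated pre-INP of \<open>W\<close> is replaced by its auxiliary edge. This is possible because
  overlapping isolated pre-INPs contain each other and so coincide as subwords, and then they
  come from the same oriented auxiliary edge: homotopic auxiliary edges are equal (\<open>aux_homotopic_unique\<close>). To see
  this, the injectivity of \<open>\<pi>\<^sub>1\<close> on the vertex spaces moves the homotopy into the relative part \<open>X\<close>, and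
  the map from \<open>X\<close> to a circle that collapses the complement of one open half-edge counts the crossings of that
  half-edge. The same argument shows that no pre-INP is trivial.

  Finally the new path must be reduced in \<open>X\<close> (\<open>isolated_no_backtrack\<close>). It could only fail to be so
  where two successive auxiliary edges run along the same half-edge. Unless they are inverse to each other, they are two
  sides of a tripod, the third side is homotopic to their composition, and by uniqueness its pre-INP is the
  concatenation of theirs. This larger pre-INP in \<open>W\<close> contradicts the assumption that they were isolated.\<close>


section \<open>Reparametrised paths\<close>

text \<open>A path \<open>p\<close> is its own composition with the unit interval, which is convex; so two reparametrisations of \<open>p\<close>
  with the same endpoints are homotopic by the straight-line homotopy of the parameters. This supplies the
  groupoid laws for paths in an arbitrary topological space, with constant paths as units.\<close>

lemma homotopic_paths_interval:
  fixes p :: "real \<Rightarrow> 'a::topological_space"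
  assumes p: "path p" "path_image p \<subseteq> S"
    and "path \<alpha>" "path \<beta>" and im: "path_image \<alpha> \<subseteq> {0..1}" "path_image \<beta> \<subseteq> {0..1}"
    and "pathstart \<alpha> = pathstart \<beta>" "pathfinish \<alpha> = pathfinish \<beta>"
  shows "homotopic_paths S (p \<circ> \<alpha>) (p \<circ> \<beta>)"
proof (rule homotopic_paths_continuous_image)
  show "homotopic_paths {0..1} \<alpha> \<beta>"
  proof (rule homotopic_paths_linear)
    fix t :: real assume "t \<in> {0..1}"
    then have "\<alpha> t \<in> {0..1}" "\<beta> t \<in> {0..1}" using im by (force simp: path_image_def)+
    then show "closed_segment (\<alpha> t) (\<beta> t) \<subseteq> {0..1}"
      by (intro closed_segment_subset) auto
  qed (use assms in auto)
  show "continuous_on {0..1} p" using p(1) by (simp add: path_def)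
  show "p \<in> {0..1} \<rightarrow> S" using p(2) by (auto simp: path_image_def)
qed

lemma sub_path_linepath: "sub_path a b p = p \<circ> linepath a b"
  by (auto simp: sub_path_def linepath_def fun_eq_iff algebra_simps)

lemma sub_path_full [simp]: "sub_path 0 1 p = p"
  by (simp add: sub_path_def)

lemma reversepath_sub_path: "reversepath (sub_path a b p) = sub_path b a p"
  by (simp add: sub_path_def reversepath_def fun_eq_iff algebra_simps)

lemma pathstart_sub_path [simp]: "pathstart (sub_path a b p) = p a"
  and pathfinish_sub_path [simp]: "pathfinish (sub_path a b p) = p b"
  by (simp_all add: sub_path_def pathstart_def pathfinish_def)

lemma path_image_linepath_unit: "a \<in> {0..1} \<Longrightarrow> b \<in> {0..1} \<Longrightarrow> path_image (linepath a b) \<subseteq> {0..1::real}"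
  by (auto simp: closed_segment_eq_real_ivl split: if_splits)

lemma path_sub_path:
  assumes "path p" "a \<in> {0..1}" "b \<in> {0..1}" shows "path (sub_path a b p)"
  using assms path_image_linepath_unit[OF assms(2,3)] unfolding sub_path_linepath path_def
  by (intro continuous_on_compose2[OF assms(1)[unfolded path_def], of _ "linepath a b", folded o_def])
     (auto simp: path_image_def)

lemma path_image_sub_path:
  assumes "a \<in> {0..1}" "b \<in> {0..1}" shows "path_image (sub_path a b p) \<subseteq> path_image p"
  using path_image_linepath_unit[OF assms] unfolding sub_path_linepath path_image_def by auto

lemma homotopic_sub_path_join:
  fixes p :: "real \<Rightarrow> 'a::topological_space"
  assumes "path p" "path_image p \<subseteq> S" "a \<in> {0..1}" "b \<in> {0..1}" "c \<in> {0..1}"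
  shows "homotopic_paths S (sub_path a b p +++ sub_path b c p) (sub_path a c p)"
  unfolding sub_path_linepath path_compose_join[symmetric]
  using path_image_linepath_unit assms(3-)
  by (intro homotopic_paths_interval assms) (auto simp: path_image_join)

lemma homotopic_paths_join_const:
  fixes p :: "real \<Rightarrow> 'a::topological_space"
  assumes "path p" "path_image p \<subseteq> S" "x = pathfinish p"
  shows "homotopic_paths S (p +++ (\<lambda>_. x)) p"
  using homotopic_sub_path_join[OF assms(1,2), of 0 1 1] assms(3)
  by (simp add: sub_path_def pathfinish_def)

lemma homotopic_paths_const_join:
  fixes p :: "real \<Rightarrow> 'a::topological_space"
  assumes "path p" "path_image p \<subseteq> S" "x = pathstart p"
  shows "homotopic_paths S ((\<lambda>_. x) +++ p) p"
  using homotopic_sub_path_join[OF assms(1,2), of 0 0 1] assms(3)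
  by (simp add: sub_path_def pathstart_def)

lemma homotopic_paths_join_reverse:
  fixes p :: "real \<Rightarrow> 'a::topological_space"
  assumes "path p" "path_image p \<subseteq> S" "x = pathstart p"
  shows "homotopic_paths S (p +++ reversepath p) (\<lambda>_. x)"
  using homotopic_sub_path_join[OF assms(1,2), of 0 1 0] assms(3)
  by (simp flip: reversepath_sub_path[of 0 1]) (simp add: sub_path_def pathstart_def)

lemma path_constant [simp]: "path (\<lambda>_. x)"
  by (simp add: path_def)

lemma pathstart_constant [simp]: "pathstart (\<lambda>_. x) = x"
  and pathfinish_constant [simp]: "pathfinish (\<lambda>_. x) = x"
  by (simp_all add: pathstart_def pathfinish_def)

section \<open>Tight words\<close>

text \<open>Free reduction for words whose first and last segments may be partial: two successive segments that meet at the
  same point of the same edge are merged into one, or removed if nothing remains. On full segments this is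
  ordinary cancellation.\<close>

definition join_segs :: "'e seg \<Rightarrow> 'e seg \<Rightarrow> 'e seg list" where
  "join_segs s t = (if fst (snd s) = snd (snd t) then [] else [(fst s, fst (snd s), snd (snd t))])"

definition push :: "'e seg \<Rightarrow> 'e seg list \<Rightarrow> 'e seg list" where
  "push s w = (case w of [] \<Rightarrow> [s] | t # w' \<Rightarrow> if backtrack s t then join_segs s t @ w' else s # w)"

definition tighten :: "'e seg list \<Rightarrow> 'e seg list \<Rightarrow> 'e seg list" where
  "tighten u w = foldr push u w"

definition nontrivial_seg :: "'e seg \<Rightarrow> bool" where
  "nontrivial_seg s \<longleftrightarrow> fst (snd s) \<noteq> snd (snd s)"

definition tight :: "'e seg list \<Rightarrow> bool" where
  "tight w \<longleftrightarrow> successively (\<lambda>s t. \<not> backtrack s t) w \<and> (\<forall>s\<in>set w. nontrivial_seg s)"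

lemma tight_Nil [simp]: "tight []"
  by (simp add: tight_def)

lemma tight_Cons:
  "tight (s # w) \<longleftrightarrow> nontrivial_seg s \<and> tight w \<and> (w \<noteq> [] \<longrightarrow> \<not> backtrack s (hd w))"
  by (auto simp: tight_def successively_Cons)

lemma tight_append:
  "tight (u @ v) \<longleftrightarrow> tight u \<and> tight v \<and> (u \<noteq> [] \<and> v \<noteq> [] \<longrightarrow> \<not> backtrack (last u) (hd v))"
  by (auto simp: tight_def successively_append_iff)

lemma rev_seg_simps [simp]:
  "fst (rev_seg s) = fst s" "fst (snd (rev_seg s)) = snd (snd s)" "snd (snd (rev_seg s)) = fst (snd s)"
  "rev_seg (rev_seg s) = s" "nontrivial_seg (rev_seg s) = nontrivial_seg s"
  by (auto simp: rev_seg_def nontrivial_seg_def)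

lemma rev_word_simps [simp]:
  "rev_word [] = []" "rev_word (s # w) = rev_word w @ [rev_seg s]"
  "rev_word (u @ v) = rev_word v @ rev_word u" "rev_word (rev_word w) = w"
  "length (rev_word w) = length w" "rev_word w = [] \<longleftrightarrow> w = []"
  by (auto simp: rev_word_def rev_map comp_def)

lemma tight_push:
  assumes "tight w" "nontrivial_seg s" shows "tight (push s w)"
proof (cases w)
  case (Cons t w')
  have "tight (join_segs s t @ w')" if "backtrack s t"
    using that assms unfolding Cons join_segs_def
    by (auto simp: tight_Cons tight_append backtrack_def nontrivial_seg_def)
  then show ?thesis
    using assms by (auto simp: Cons push_def tight_Cons)
qed (use assms in \<open>simp add: push_def tight_Cons\<close>)

text \<open>Together with \<open>tight_push\<close> this says that non-trivial segments act on tight words by bijections, as the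
  generators of a free group act on reduced words.\<close>

lemma push_rev_push:
  assumes "tight w" "nontrivial_seg s" shows "push (rev_seg s) (push s w) = w"
proof (cases w)
  case (Cons t w')
  show ?thesis
  proof (cases "backtrack s t \<and> fst (snd s) = snd (snd t)")
    case True
    then have "rev_seg s = t" by (auto simp: rev_seg_def backtrack_def prod_eq_iff)
    with True show ?thesis using assms
      by (cases w') (auto simp: Cons push_def join_segs_def backtrack_def tight_Cons)
  next
    case False
    then show ?thesis using assms
      by (auto simp: Cons push_def join_segs_def backtrack_def nontrivial_seg_def tight_Cons prod_eq_iff)
  qed
qed (auto simp: push_def backtrack_def join_segs_def)

lemma tighten_simps [simp]: "tighten [] w = w" "tighten (s # u) w = push s (tighten u w)"
  "tighten (u @ v) w = tighten u (tighten v w)"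
  by (simp_all add: tighten_def)

lemma tight_tighten: "tight w \<Longrightarrow> \<forall>s\<in>set u. nontrivial_seg s \<Longrightarrow> tight (tighten u w)"
  by (induction u) (auto simp: tight_push)

lemma tighten_rev_tighten:
  "tight w \<Longrightarrow> \<forall>s\<in>set u. nontrivial_seg s \<Longrightarrow> tighten (rev_word u) (tighten u w) = w"
  by (induction u) (auto simp: push_rev_push tight_tighten)

lemma tighten_tight: "tight w \<Longrightarrow> tighten w [] = w"
  by (induction w) (auto simp: tight_Cons push_def split: list.split)

lemma set_rev_word: "set (rev_word w) = rev_seg ` set w"
  by (auto simp: rev_word_def)

text \<open>Words are compared through \<open>v\<inverse>w\<close>: if it reduces to the trivial word, letting \<open>v\<close> act again gives \<open>w = v\<close>.\<close>

lemma tighten_rev_eq_Nil: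
  assumes "tight v" "tight w" "tighten (rev_word v) w = []" shows "v = w"
proof -
  have "tighten v (tighten (rev_word v) w) = w"
    using tighten_rev_tighten[OF assms(2), of "rev_word v"] assms(1)
    by (auto simp: set_rev_word tight_def)
  with assms show ?thesis by (simp add: tighten_tight)
qed


section \<open>Walks\<close>

locale nielsen_graph =
  fixes G :: "('a::t2_space, 'e) nielsen_complex"
  assumes cell: "cell_complex G" and aux_structure: "auxiliary_structure G"
begin

lemma aux_disjoint: "e \<in> aux G \<Longrightarrow> e \<notin> hat G" "e \<in> aux G \<Longrightarrow> e \<notin> gam G" "e \<in> aux G \<Longrightarrow> e \<notin> half G"
  using cell by (auto simp: cell_complex_def cells1_def disjnt_iff)

lemma half_disjoint: "h \<in> half G \<Longrightarrow> h \<notin> hat G" "h \<in> half G \<Longrightarrow> h \<notin> gam G"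
  using cell by (auto simp: cell_complex_def cells1_def disjnt_iff)

lemma legs_half:
  assumes "e \<in> aux G"
  shows "fst (legs G e) \<in> half G" "snd (legs G e) \<in> half G" "fst (legs G e) \<noteq> snd (legs G e)"
    "emap G (fst (legs G e)) 1 = emap G (snd (legs G e)) 1"
  using assms aux_structure by (auto simp: auxiliary_structure_def)

lemma emap_path: "e \<in> cells1 G \<Longrightarrow> path (emap G e)"
  using cell by (auto simp: cell_complex_def path_def)

lemma edge_map_eq: "e \<in> hat G \<union> gam G \<Longrightarrow> edge_map G e = emap G e"
  using aux_disjoint by (auto simp: edge_map_def)

lemma edge_map_path:
  assumes "e \<in> hat G \<union> gam G \<union> aux G" shows "path (edge_map G e)"
proof (cases "e \<in> aux G")
  case True
  then show ?thesis using legs_half[OF True] emap_path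
    by (auto simp: edge_map_def cells1_def pathfinish_def pathstart_reversepath intro!: path_join_imp)
next
  case False
  with assms show ?thesis by (auto simp: edge_map_eq cells1_def intro: emap_path)
qed

lemma edge_map_rel_part:
  assumes "e \<in> gam G \<union> aux G" shows "path_image (edge_map G e) \<subseteq> rel_part G"
proof (cases "e \<in> aux G")
  case True
  have "path_image (edge_map G e) \<subseteq> path_image (emap G (fst (legs G e))) \<union> path_image (emap G (snd (legs G e)))"
    using True path_image_join_subset[of "emap G (fst (legs G e))" "reversepath (emap G (snd (legs G e)))"]
    by (simp add: edge_map_def)
  then show ?thesis using legs_half(1,2)[OF True] by (force simp: rel_part_def path_image_def)
next
  case False
  with assms show ?thesis by (auto simp: edge_map_eq rel_part_def path_image_def)
qed

lemma rel_part_G2: "rel_part G \<subseteq> G2 G"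
  by (auto simp: G1_def G2_def)

lemma edge_map_G2:
  assumes "e \<in> hat G \<union> gam G \<union> aux G" shows "path_image (edge_map G e) \<subseteq> G2 G"
proof (cases "e \<in> hat G")
  case True
  then show ?thesis by (auto simp: edge_map_eq G2_def G1_def path_image_def)
next
  case False
  with assms edge_map_rel_part[of e] rel_part_G2 show ?thesis by auto
qed

lemma valid_segD:
  assumes "valid_seg G s"
  shows "fst s \<in> hat G \<union> gam G \<union> aux G" "fst (snd s) \<in> {0..1}" "snd (snd s) \<in> {0..1}"
    "nontrivial_seg s" "valid_seg G (rev_seg s)"
    "fst s \<notin> hat G \<Longrightarrow> full_seg s"
  using assms by (auto simp: valid_seg_def full_seg_def nontrivial_seg_def prod_eq_iff)

lemma edge_map_verts:
  assumes "e \<in> hat G \<union> gam G \<union> aux G" "a \<in> {0, 1}" shows "edge_map G e a \<in> verts G"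
proof -
  have "\<forall>h\<in>half G. emap G h 0 \<in> verts G" "\<forall>h\<in>hat G \<union> gam G. emap G h 0 \<in> verts G \<and> emap G h 1 \<in> verts G"
    using cell by (auto simp: cell_complex_def)
  moreover have "edge_map G e 0 = emap G (fst (legs G e)) 0 \<and> edge_map G e 1 = emap G (snd (legs G e)) 0" if "e \<in> aux G"
    using that by (simp add: edge_map_def joinpaths_def reversepath_def)
  ultimately show ?thesis using assms edge_map_eq legs_half(1,2) by (cases "e \<in> aux G") auto
qed

text \<open>A point inside an edge of the train track part determines the edge and the parameter, because open cells are disjoint and
  injectively parametrised.\<close>

lemma interior_point:
  assumes "e \<in> hat G" "a \<in> {0<..<1}" "e' \<in> hat G \<union> gam G \<union> aux G" "b \<in> {0..1}"
    "e' \<in> hat G \<or> b \<in> {0, 1}" "emap G e a = edge_map G e' b"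
  shows "e' = e \<and> b = a"
proof -
  have op: "emap G e a \<in> open_edge G e" using assms(2) by (auto simp: open_edge_def)
  have e: "e \<in> cells1 G" using assms(1) by (auto simp: cells1_def)
  have nv: "emap G e a \<notin> verts G" using op e cell by (auto simp: cell_complex_def)
  then have b: "b \<notin> {0, 1}" using edge_map_verts[OF assms(3)] assms(6) by metis
  with assms(5) have h: "e' \<in> hat G" by blast
  with assms(6) have eq: "emap G e a = emap G e' b" by (simp add: edge_map_eq)
  have "b \<in> {0<..<1}" using b assms(4) by auto
  then have "emap G e' b \<in> open_edge G e'" by (auto simp: open_edge_def)
  moreover have "e' \<in> cells1 G" using h by (auto simp: cells1_def)
  ultimately have "e' = e" using op e eq cell unfolding cell_complex_def by (metis disjoint_iff)
  moreover have "inj_on (emap G e) {0<..<1}" using e cell by (auto simp: cell_complex_def)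
  ultimately show ?thesis using eq \<open>b \<in> {0<..<1}\<close> assms(2) by (metis inj_onD)
qed

text \<open>Segments that meet inside an edge lie on the same edge and meet there at the same parameter, which is
  \<open>backtrack\<close> even if they continue in the same direction.\<close>

lemma seg_ends_at_vertex:
  assumes "valid_seg G s" "valid_seg G t" "seg_end G s = seg_start G t" "\<not> backtrack s t"
  shows "snd (snd s) \<in> {0, 1}" "fst (snd t) \<in> {0, 1}"
proof -
  have *: "fst s \<in> hat G \<or> snd (snd s) \<in> {0,1}" "fst t \<in> hat G \<or> fst (snd t) \<in> {0,1}"
    using assms(1,2)[THEN valid_segD(6)] by (auto simp: full_seg_def)
  have **: "snd (snd s) \<in> {0..1}" "fst (snd t) \<in> {0..1}" "fst s \<in> hat G \<union> gam G \<union> aux G" "fst t \<in> hat G \<union> gam G \<union> aux G"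
    using assms(1,2) by (auto dest: valid_segD)
  have eq: "edge_map G (fst s) (snd (snd s)) = edge_map G (fst t) (fst (snd t))"
    using assms(3) by (simp add: seg_end_def seg_start_def)
  show "snd (snd s) \<in> {0, 1}"
  proof (rule ccontr)
    assume "\<not> ?thesis"
    with * ** have "fst s \<in> hat G" "snd (snd s) \<in> {0<..<1}" by auto
    with interior_point[of "fst s" "snd (snd s)" "fst t" "fst (snd t)"] * ** eq assms(4) show False
      by (auto simp: edge_map_eq backtrack_def)
  qed
  show "fst (snd t) \<in> {0, 1}"
  proof (rule ccontr)
    assume "\<not> ?thesis"
    with * ** have "fst t \<in> hat G" "fst (snd t) \<in> {0<..<1}" by auto
    with interior_point[of "fst t" "fst (snd t)" "fst s" "snd (snd s)"] * ** eq assms(4) show False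
      by (auto simp: edge_map_eq backtrack_def)
  qed
qed

text \<open>Unlike in a path, breakpoints inside an edge and backtracking are allowed, so that walks can be
  concatenated, reversed and split without side conditions.\<close>

primrec walk :: "'a \<Rightarrow> 'e seg list \<Rightarrow> 'a \<Rightarrow> bool" where
  "walk x [] y \<longleftrightarrow> x = y \<and> x \<in> G2 G"
| "walk x (s # w) y \<longleftrightarrow> valid_seg G s \<and> seg_start G s = x \<and> walk (seg_end G s) w y"

lemma seg_G2:
  assumes "valid_seg G s" shows "seg_start G s \<in> G2 G" "seg_end G s \<in> G2 G"
  using edge_map_G2[OF valid_segD(1)[OF assms]] valid_segD(2,3)[OF assms]
  by (auto simp: seg_start_def seg_end_def path_image_def)

lemma walk_G2: "walk x w y \<Longrightarrow> x \<in> G2 G \<and> y \<in> G2 G"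
  by (induction w arbitrary: x) (auto simp: seg_G2)

lemma walk_append: "walk x (u @ v) z \<longleftrightarrow> (\<exists>y. walk x u y \<and> walk y v z)"
  by (induction u arbitrary: x) (auto dest: walk_G2)

lemma walk_nontrivial: "walk x w y \<Longrightarrow> \<forall>s\<in>set w. nontrivial_seg s"
  by (induction w arbitrary: x) (auto dest: valid_segD)

lemma walk_valid: "walk x w y \<Longrightarrow> s \<in> set w \<Longrightarrow> valid_seg G s"
  by (induction w arbitrary: x) auto

lemma walk_tight_iff:
  "walk x w y \<Longrightarrow> tight w \<longleftrightarrow> successively (\<lambda>s t. \<not> backtrack s t) w"
  using walk_nontrivial by (auto simp: tight_def)

lemma seg_start_rev [simp]: "seg_start G (rev_seg s) = seg_end G s"
  and seg_end_rev [simp]: "seg_end G (rev_seg s) = seg_start G s"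
  by (simp_all add: seg_start_def seg_end_def)

lemma walk_rev: "walk x w y \<Longrightarrow> walk y (rev_word w) x"
proof (induction w arbitrary: x)
  case (Cons s w)
  then show ?case by (auto simp: walk_append seg_G2 dest: valid_segD)
qed auto

lemma backtrack_seg_end: "backtrack s t \<Longrightarrow> seg_end G s = seg_start G t"
  by (simp add: backtrack_def seg_end_def seg_start_def)

lemma valid_join_segs:
  assumes "valid_seg G s" "valid_seg G t" "backtrack s t"
  shows "walk (seg_start G s) (join_segs s t) (seg_end G t)"
  using assms seg_G2[OF assms(1)] seg_G2[OF assms(2)]
  by (auto simp: join_segs_def backtrack_def seg_start_def seg_end_def valid_seg_def full_seg_def prod_eq_iff)

lemma walk_push:
  assumes "valid_seg G s" "walk (seg_end G s) w y" shows "walk (seg_start G s) (push s w) y"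
proof (cases w)
  case (Cons t w')
  then show ?thesis using assms valid_join_segs[of s t] by (auto simp: push_def walk_append)
qed (use assms in \<open>auto simp: push_def\<close>)

lemma walk_tighten: "walk x u y \<Longrightarrow> walk y w z \<Longrightarrow> walk x (tighten u w) z"
  by (induction u arbitrary: x) (auto simp: walk_push)

section \<open>Homotopy of walks\<close>

lemma path_track:
  assumes "walk x w y"
  shows "path (track G x w)" "path_image (track G x w) \<subseteq> G2 G"
    "pathstart (track G x w) = x" "pathfinish (track G x w) = y"
proof -
  have "path (track G x w) \<and> path_image (track G x w) \<subseteq> G2 G \<and>
    pathstart (track G x w) = x \<and> pathfinish (track G x w) = y"
    using assms
  proof (induction w arbitrary: x)
    case (Cons s w)
    let ?p = "sub_path (fst (snd s)) (snd (snd s)) (edge_map G (fst s))"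
    have s: "valid_seg G s" "seg_start G s = x" using Cons.prems by auto
    note v = valid_segD(1-3)[OF s(1)]
    have p: "path ?p" "path_image ?p \<subseteq> G2 G"
      using path_sub_path[OF edge_map_path[OF v(1)] v(2,3)] path_image_sub_path[OF v(2,3)] edge_map_G2[OF v(1)] by auto
    from Cons.IH[of "seg_end G s"] Cons.prems
    have IH: "path (track G (seg_end G s) w)" "path_image (track G (seg_end G s) w) \<subseteq> G2 G"
      "pathstart (track G (seg_end G s) w) = seg_end G s" "pathfinish (track G (seg_end G s) w) = y" by auto
    then show ?case using p s path_image_join_subset[of ?p "track G (seg_end G s) w"]
      by (auto simp: seg_end_def seg_start_def)
  qed (auto dest: walk_G2)
  then show "path (track G x w)" "path_image (track G x w) \<subseteq> G2 G"
    "pathstart (track G x w) = x" "pathfinish (track G x w) = y" by auto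
qed

definition homotopic_words :: "'a \<Rightarrow> 'e seg list \<Rightarrow> 'e seg list \<Rightarrow> bool" where
  "homotopic_words x u v \<longleftrightarrow> homotopic_paths (G2 G) (track G x u) (track G x v)"

lemma homotopic_words_refl: "walk x u y \<Longrightarrow> homotopic_words x u u"
  by (simp add: homotopic_words_def path_track)

lemma homotopic_words_sym: "homotopic_words x u v \<Longrightarrow> homotopic_words x v u"
  by (simp add: homotopic_words_def homotopic_paths_sym)

lemma homotopic_words_trans [trans]: "homotopic_words x u v \<Longrightarrow> homotopic_words x v w \<Longrightarrow> homotopic_words x u w"
  unfolding homotopic_words_def by (rule homotopic_paths_trans)

lemma track_append:
  "walk x u y \<Longrightarrow> walk y v z \<Longrightarrow> homotopic_paths (G2 G) (track G x (u @ v)) (track G x u +++ track G y v)"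
proof (induction u arbitrary: x)
  case Nil
  then show ?case using homotopic_paths_const_join[of "track G y v" "G2 G" y] path_track[of y v z]
    by (auto simp: homotopic_paths_sym)
next
  case (Cons s u)
  let ?p = "sub_path (fst (snd s)) (snd (snd s)) (edge_map G (fst s))"
  have s: "valid_seg G s" "seg_start G s = x" "walk (seg_end G s) u y" using Cons.prems by auto
  note v = valid_segD(1-3)[OF s(1)]
  have p: "path ?p" "path_image ?p \<subseteq> G2 G"
    using path_sub_path[OF edge_map_path[OF v(1)] v(2,3)] path_image_sub_path[OF v(2,3)] edge_map_G2[OF v(1)] by auto
  have uv: "walk (seg_end G s) (u @ v) z" using s(3) Cons.prems(2) by (auto simp: walk_append)
  have 1: "homotopic_paths (G2 G) (?p +++ track G (seg_end G s) (u @ v)) (?p +++ (track G (seg_end G s) u +++ track G y v))"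
    using Cons.IH[OF s(3) Cons.prems(2)] p path_track(3)[OF uv]
    by (intro homotopic_paths_join) (auto simp: seg_end_def)
  have "homotopic_paths (G2 G) (?p +++ (track G (seg_end G s) u +++ track G y v)) ((?p +++ track G (seg_end G s) u) +++ track G y v)"
    using p path_track[OF s(3)] path_track[OF Cons.prems(2)] by (intro homotopic_paths_assoc) (auto simp: seg_end_def)
  with 1 show ?case by (auto intro: homotopic_paths_trans)
qed

lemma homotopic_words_append:
  assumes "walk x u y" "walk x u' y" "homotopic_words x u u'" "walk y v z" "walk y v' z" "homotopic_words y v v'"
  shows "homotopic_words x (u @ v) (u' @ v')"
proof -
  have "homotopic_paths (G2 G) (track G x (u @ v)) (track G x u +++ track G y v)"
    by (rule track_append) fact+
  also have "homotopic_paths (G2 G) \<dots> (track G x u' +++ track G y v')"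
    using assms path_track[OF assms(1)] path_track[OF assms(4)] unfolding homotopic_words_def by (intro homotopic_paths_join) auto
  also have "homotopic_paths (G2 G) \<dots> (track G x (u' @ v'))"
    using track_append[OF assms(2,5)] by (rule homotopic_paths_sym)
  finally show ?thesis by (simp add: homotopic_words_def)
qed

lemma track_single:
  assumes "valid_seg G s"
  shows "homotopic_paths (G2 G) (track G (seg_start G s) [s]) (sub_path (fst (snd s)) (snd (snd s)) (edge_map G (fst s)))"
proof -
  note v = valid_segD(1-3)[OF assms]
  show ?thesis
    using path_sub_path[OF edge_map_path[OF v(1)] v(2,3)] path_image_sub_path[OF v(2,3), of "edge_map G (fst s)"] edge_map_G2[OF v(1)]
    by (auto simp: seg_end_def intro!: homotopic_paths_join_const)
qed

text \<open>Both sides run along a single edge, where only the endpoints matter.\<close>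

lemma homotopic_words_join_segs:
  assumes "valid_seg G s" "valid_seg G t" "backtrack s t"
  shows "homotopic_words (seg_start G s) [s, t] (join_segs s t)"
proof -
  let ?e = "edge_map G (fst s)" and ?a = "fst (snd s)" and ?b = "snd (snd s)" and ?c = "snd (snd t)"
  have w: "walk (seg_start G s) [s] (seg_end G s)" "walk (seg_end G s) [t] (seg_end G t)"
    using assms seg_G2 by (auto simp: backtrack_seg_end)
  note v = valid_segD(1-3)[OF assms(1)] valid_segD(3)[OF assms(2)]
  have t: "fst t = fst s" "fst (snd t) = ?b" using assms(3) by (auto simp: backtrack_def)
  have "homotopic_paths (G2 G) (track G (seg_start G s) ([s] @ [t]))
    (track G (seg_start G s) [s] +++ track G (seg_end G s) [t])"
    by (rule track_append[OF w])
  also have "homotopic_paths (G2 G) \<dots> (sub_path ?a ?b ?e +++ sub_path ?b ?c ?e)"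
    using track_single[OF assms(1)] track_single[OF assms(2)] path_track[OF w(1)] path_track[OF w(2)]
      backtrack_seg_end[OF assms(3)] t
    by (intro homotopic_paths_join) auto
  also have "homotopic_paths (G2 G) \<dots> (sub_path ?a ?c ?e)"
    using v edge_map_path[OF v(1)] edge_map_G2[OF v(1)] by (intro homotopic_sub_path_join)
  also have "homotopic_paths (G2 G) \<dots> (track G (seg_start G s) (join_segs s t))"
  proof (cases "?a = ?c")
    case True
    then show ?thesis using seg_G2[OF assms(1)] by (simp add: join_segs_def sub_path_def seg_start_def)
  next
    case False
    then have "valid_seg G (fst s, ?a, ?c)"
      using valid_join_segs[OF assms] by (simp add: join_segs_def)
    from track_single[OF this] False show ?thesis
      by (simp add: join_segs_def seg_start_def homotopic_paths_sym del: track.simps)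
  qed
  finally show ?thesis by (simp add: homotopic_words_def)
qed

lemma homotopic_words_push:
  assumes "valid_seg G s" "walk (seg_end G s) w y"
  shows "homotopic_words (seg_start G s) (s # w) (push s w)"
proof (cases "w \<noteq> [] \<and> backtrack s (hd w)")
  case True
  then obtain t w' where w: "w = t # w'" by (cases w) auto
  have "walk (seg_start G s) [s, t] (seg_end G t)" "valid_seg G t" "walk (seg_end G t) w' y"
    using assms True w seg_G2 by auto
  then have "homotopic_words (seg_start G s) ([s, t] @ w') (join_segs s t @ w')"
    using valid_join_segs[of s t] homotopic_words_join_segs[of s t] assms(1) True w
    by (intro homotopic_words_append) (auto intro: homotopic_words_refl)
  with True w show ?thesis by (simp add: push_def)
next
  case False
  then have "push s w = s # w" by (auto simp: push_def split: list.split)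
  with assms homotopic_words_refl[of "seg_start G s" "s # w" y] show ?thesis by simp
qed

lemma homotopic_words_Cons:
  assumes "valid_seg G s" "walk (seg_end G s) u y" "walk (seg_end G s) v y" "homotopic_words (seg_end G s) u v"
  shows "homotopic_words (seg_start G s) (s # u) (s # v)"
proof -
  have "walk (seg_start G s) [s] (seg_end G s)" using assms(1) seg_G2 by auto
  from homotopic_words_append[OF this this homotopic_words_refl[OF this] assms(2-4)] show ?thesis by simp
qed

lemma homotopic_words_tighten:
  "walk x u y \<Longrightarrow> walk y w z \<Longrightarrow> homotopic_words x (u @ w) (tighten u w)"
proof (induction u arbitrary: x)
  case Nil then show ?case by (auto intro: homotopic_words_refl)
next
  case (Cons s u)
  have s: "valid_seg G s" "seg_start G s = x" "walk (seg_end G s) u y" using Cons.prems by auto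
  have "homotopic_words x (s # (u @ w)) (s # tighten u w)"
    using s Cons homotopic_words_Cons[OF s(1), of "u @ w" z "tighten u w"] walk_tighten by (auto simp: walk_append)
  also have "homotopic_words x \<dots> (push s (tighten u w))"
    using homotopic_words_push[of s "tighten u w" z] s Cons.prems walk_tighten by auto
  finally show ?case by simp
qed

lemma homotopic_words_rev_cancel:
  assumes "walk x u y" shows "homotopic_words x (u @ rev_word u) []"
  using assms
proof (induction u arbitrary: x)
  case Nil from homotopic_words_refl[OF this] show ?case by simp
next
  case (Cons s u)
  have s: "valid_seg G s" "seg_start G s = x" "walk (seg_end G s) u y" using Cons.prems by auto
  have r: "valid_seg G (rev_seg s)" "backtrack s (rev_seg s)" "join_segs s (rev_seg s) = []"
    using valid_segD(5)[OF s(1)] by (auto simp: backtrack_def join_segs_def)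
  have w: "walk x [s] (seg_end G s)" "walk (seg_end G s) (u @ rev_word u) (seg_end G s)"
    "walk (seg_end G s) [] (seg_end G s)" "walk (seg_end G s) [rev_seg s] x"
    using s r seg_G2(1)[OF s(1)] seg_G2(2)[OF s(1)] walk_rev[OF s(3)] by (auto simp: walk_append)
  have "homotopic_words x ([s] @ ((u @ rev_word u) @ [rev_seg s])) ([s] @ ([] @ [rev_seg s]))"
    using w Cons.IH[OF s(3)] homotopic_words_refl by (intro homotopic_words_append) (auto simp: walk_append)
  also have "homotopic_words x \<dots> []" using homotopic_words_join_segs[OF s(1) r(1,2)] s r by simp
  finally show ?case by simp
qed

end


section \<open>Paths as walks\<close>

context nielsen_graph begin

lemma walk_successively:
  assumes "walk x w y"
  shows "successively (\<lambda>s t. seg_end G s = seg_start G t) w" "w \<noteq> [] \<Longrightarrow> seg_start G (hd w) = x"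
    "w \<noteq> [] \<Longrightarrow> seg_end G (last w) = y"
proof -
  have "successively (\<lambda>s t. seg_end G s = seg_start G t) w \<and> (w \<noteq> [] \<longrightarrow> seg_start G (hd w) = x \<and> seg_end G (last w) = y)"
    using assms
  proof (induction w arbitrary: x)
    case (Cons s w)
    then show ?case by (cases w) (auto simp: successively_Cons)
  qed auto
  then show "successively (\<lambda>s t. seg_end G s = seg_start G t) w" "w \<noteq> [] \<Longrightarrow> seg_start G (hd w) = x"
    "w \<noteq> [] \<Longrightarrow> seg_end G (last w) = y" by auto
qed

text \<open>By \<open>seg_ends_at_vertex\<close> the absence of backtracking forces all breakpoints to be vertices.\<close>

lemma walk_joined:
  assumes "walk x w y" "successively (\<lambda>s t. \<not> backtrack s t) w" shows "joined G w"
  unfolding joined_def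
proof (intro allI impI)
  fix i assume i: "Suc i < length w"
  have "valid_seg G (w ! i)" "valid_seg G (w ! Suc i)" using walk_valid[OF assms(1)] i by auto
  moreover have "seg_end G (w ! i) = seg_start G (w ! Suc i)" "\<not> backtrack (w ! i) (w ! Suc i)"
    using walk_successively(1)[OF assms(1)] assms(2) i by (auto simp: successively_conv_nth)
  ultimately show "snd (snd (w ! i)) \<in> {0, 1} \<and> fst (snd (w ! Suc i)) \<in> {0, 1} \<and> seg_end G (w ! i) = seg_start G (w ! Suc i)"
    using seg_ends_at_vertex by blast
qed

lemma joined_full_word:
  assumes "joined G w" "fst (snd (hd w)) \<in> {0, 1}" "snd (snd (last w)) \<in> {0, 1}" "\<forall>s\<in>set w. nontrivial_seg s"
  shows "full_word w"
proof -
  have "full_seg (w ! i)" if i: "i < length w" for i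
  proof -
    have "fst (snd (w ! i)) \<in> {0, 1}"
      using assms(1,2) i by (cases i) (auto simp: hd_conv_nth joined_def)
    moreover have "snd (snd (w ! i)) \<in> {0, 1}"
    proof (cases "Suc i < length w")
      case True then show ?thesis using assms(1) by (simp add: joined_def)
    next
      case False
      with i have "w ! i = last w" by (metis Suc_lessI diff_Suc_1 last_conv_nth length_0_conv not_less0)
      with assms(3) show ?thesis by simp
    qed
    moreover have "nontrivial_seg (w ! i)" using assms(4) i by auto
    ultimately show ?thesis by (auto simp: full_seg_def nontrivial_seg_def prod_eq_iff)
  qed
  then show ?thesis unfolding full_word_def by (metis in_set_conv_nth)
qed

lemma endpoints_G2: "endpoints G \<subseteq> G2 G"
  by (force simp: endpoints_def G2_def G1_def rel_part_def open_edge_def)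

lemma is_path_walk:
  assumes "is_path G (x, w)" obtains y where "walk x w y"
proof -
  have "\<exists>y. walk x w y"
    if "x \<in> G2 G" "w \<noteq> [] \<longrightarrow> x = seg_start G (hd w)" "\<forall>s\<in>set w. valid_seg G s" "joined G w" for x
    using that
  proof (induction w arbitrary: x)
    case (Cons s w)
    have "\<forall>i. Suc i < length (s # w) \<longrightarrow> seg_end G ((s # w) ! i) = seg_start G ((s # w) ! Suc i)"
      using Cons.prems(4) by (auto simp: joined_def)
    then have "w \<noteq> [] \<longrightarrow> seg_end G s = seg_start G (hd w)" by (cases w) fastforce+
    moreover have "joined G w" using Cons.prems(4) by (fastforce simp: joined_def)
    ultimately show ?case using Cons.IH[of "seg_end G s"] Cons.prems seg_G2[of s] by auto
  qed auto
  from this[of x] assms endpoints_G2 that show ?thesis by (auto simp: is_path_def)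
qed

lemma in_Gamma_word_cells: "in_Gamma G w \<Longrightarrow> word_cells G w = w"
  by (induction w) (use aux_disjoint in \<open>auto simp: in_Gamma_def word_cells_def seg_cells_def\<close>)

lemma reduced_word_tight:
  assumes "in_Gamma G w" "walk x w y" shows "reduced_word G w \<longleftrightarrow> tight w"
  by (auto simp: reduced_word_def in_Gamma_word_cells[OF assms(1)] walk_tight_iff[OF assms(2)] successively_conv_nth)

lemma Gamma_is_path:
  assumes "in_Gamma G w" "walk x w y" "tight w" "x \<in> endpoints G" shows "is_path G (x, w)"
proof -
  have "successively (\<lambda>s t. \<not> backtrack s t) w" using assms(3) by (simp add: tight_def)
  then show ?thesis
    using assms(4) walk_joined[OF assms(2)] walk_successively(2)[OF assms(2)] walk_valid[OF assms(2)]
    by (auto simp: is_path_def rel_part_reduced_def in_Gamma_word_cells[OF assms(1)] Let_def successively_conv_nth)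
qed

lemma in_Gamma_simps [simp]: "in_Gamma G []" "in_Gamma G (s # w) \<longleftrightarrow> fst s \<in> hat G \<union> gam G \<and> in_Gamma G w"
  "in_Gamma G (u @ v) \<longleftrightarrow> in_Gamma G u \<and> in_Gamma G v" "in_Gamma G (rev_word w) \<longleftrightarrow> in_Gamma G w"
  by (auto simp: in_Gamma_def set_rev_word)

lemma in_Gamma_push: "in_Gamma G (s # w) \<Longrightarrow> in_Gamma G (push s w)"
  by (auto simp: push_def join_segs_def split: list.split)

lemma in_Gamma_tighten: "in_Gamma G u \<Longrightarrow> in_Gamma G w \<Longrightarrow> in_Gamma G (tighten u w)"
  by (induction u) (simp_all add: in_Gamma_push[simplified])

end

section \<open>Reduced words in the graph\<close>

locale beta_map =
  fixes G :: "('a::t2_space, 'e) nielsen_complex" and f :: "'a \<Rightarrow> 'a"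
    and F :: "('g, 'm) monoid_scheme" and B :: "'g set" and \<alpha> :: "'g \<Rightarrow> 'g"
    and b :: 'a and \<theta> :: "(real \<Rightarrow> 'a) set \<Rightarrow> 'g"
  assumes beta: "beta_train_track_map G f F B \<alpha> b \<theta>"
begin

sublocale nielsen_graph G
  using beta by unfold_locales (simp_all add: beta_train_track_map_def partial_train_track_map_def)

lemma lift_end_null:
  assumes "walk x w x" "homotopic_words x w []" "path p" "path_image p \<subseteq> G2 G" "pathfinish p = x"
  shows "lift_end G (path_class (G2 G) p) (x, w) = path_class (G2 G) p"
proof -
  have *: "homotopic_paths (G2 G) (p' +++ track G x w) p'" if "homotopic_paths (G2 G) p p'" for p'
  proof -
    have p': "path p'" "path_image p' \<subseteq> G2 G" "pathfinish p' = x"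
      using that assms(5) by (auto dest: homotopic_paths_imp_path homotopic_paths_imp_subset homotopic_paths_imp_pathfinish)
    have "homotopic_paths (G2 G) (p' +++ track G x w) (p' +++ (\<lambda>_. x))"
      using assms(2) p' path_track(3)[OF assms(1)] by (intro homotopic_paths_join) (auto simp: homotopic_words_def)
    also have "homotopic_paths (G2 G) \<dots> p'" using p' by (intro homotopic_paths_join_const) auto
    finally show ?thesis .
  qed
  show ?thesis
  proof (intro equalityI subsetI)
    fix q assume "q \<in> lift_end G (path_class (G2 G) p) (x, w)"
    then obtain p' where p': "homotopic_paths (G2 G) p p'" and q: "homotopic_paths (G2 G) (p' +++ track G x w) q"
      by (auto simp: lift_end_def path_class_def realize_def)
    note p'
    also note homotopic_paths_sym[OF *[OF p']]
    also note q
    finally show "q \<in> path_class (G2 G) p" by (simp add: path_class_def)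
  next
    fix q assume "q \<in> path_class (G2 G) p"
    then have "homotopic_paths (G2 G) p q" by (simp add: path_class_def)
    with *[of q] show "q \<in> lift_end G (path_class (G2 G) p) (x, w)"
      by (auto simp: path_class_def lift_end_def realize_def)
  qed
qed

lemma covering_dist_self:
  assumes "x \<in> endpoints G" "path p" "path_image p \<subseteq> G2 G" "pathfinish p = x"
  shows "covering_dist G (path_class (G2 G) p) (path_class (G2 G) p) = 0"
  unfolding covering_dist_def
proof (rule cInf_eq_minimum)
  have x: "walk x [] x" using assms(1) endpoints_G2 by auto
  have "is_path G (x, [])" using assms(1) by (auto simp: is_path_def joined_def rel_part_reduced_def word_cells_def)
  moreover have "lift_end G (path_class (G2 G) p) (x, []) = path_class (G2 G) p"
    using lift_end_null[OF x homotopic_words_refl[OF x]] assms by auto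
  moreover have "\<forall>p'\<in>path_class (G2 G) p. pathfinish p' = x"
    using assms(4) by (auto simp: path_class_def dest: homotopic_paths_imp_pathfinish)
  ultimately show "0 \<in> {simplicial_length (snd \<delta>) |\<delta>. is_path G \<delta> \<and>
      (\<forall>p'\<in>path_class (G2 G) p. pathfinish p' = fst \<delta>) \<and> lift_end G (path_class (G2 G) p) \<delta> = path_class (G2 G) p}"
    by (intro CollectI exI[of _ "(x, [])"]) (auto simp: simplicial_length_def)
qed (auto simp: simplicial_length_def intro!: sum_list_nonneg)

lemma covering_points_nonempty:
  assumes "x \<in> G2 G"
  obtains p where "path p" "path_image p \<subseteq> G2 G" "pathfinish p = x" "path_class (G2 G) p \<in> covering_points G b x"
proof -
  have "b \<in> G2 G" using beta by (simp add: beta_train_track_map_def represents_def)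
  moreover have "path_connected (G2 G)" using cell by (simp add: cell_complex_def)
  ultimately have "\<exists>p. path p \<and> path_image p \<subseteq> G2 G \<and> pathstart p = b \<and> pathfinish p = x"
    using assms by (simp add: path_connected_def)
  then obtain p where p: "path p" "path_image p \<subseteq> G2 G" "pathstart p = b" "pathfinish p = x"
    by (elim exE conjE)
  then have "path_class (G2 G) p \<in> covering_points G b x" by (auto simp: covering_points_def)
  with p that show ?thesis by blast
qed

lemma simplicial_length_full: "full_word w \<Longrightarrow> simplicial_length w = real (length w)"
  by (induction w) (auto simp: simplicial_length_def full_word_def full_seg_def)

text \<open>The powers \<open>c\<^sup>n\<close> are reduced paths in \<open>\<Gamma>\<close>, so their lifts are quasi-geodesics with constants \<open>\<mu>\<close>
  and \<open>C\<close> that do not depend on \<open>n\<close>. If \<open>c\<close> were null-homotopic, the lift of \<open>c\<^sup>n\<close> would be closed, and the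
  lower bound \<open>length (c\<^sup>n) / \<mu> - C\<close> for the distance of its endpoints would give \<open>n \<le> \<mu> C\<close> for all \<open>n\<close>.\<close>

lemma cyclically_reduced_not_null:
  assumes c: "c \<noteq> []" "walk x c x" "in_Gamma G c" "full_word c" "tight c" "\<not> backtrack (last c) (hd c)"
    and x: "x \<in> verts G"
  shows "\<not> homotopic_words x c []"
proof
  assume null: "homotopic_words x c []"
  define p where "p n = concat (replicate n c)" for n
  have p: "walk x (p n) x \<and> homotopic_words x (p n) [] \<and> in_Gamma G (p n) \<and> full_word (p n) \<and> tight (p n) \<and>
    (n > 0 \<longrightarrow> p n \<noteq> [] \<and> hd (p n) = hd c) \<and> length (p n) = n * length c" for n
  proof (induction n)
    case 0
    have "walk x [] x" using c(2) by (auto dest: walk_G2)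
    then show ?case using homotopic_words_refl by (auto simp: p_def full_word_def)
  next
    case (Suc n)
    have s: "p (Suc n) = c @ p n" by (simp add: p_def)
    have "walk x [] x" using c(2) by (auto dest: walk_G2)
    then have "homotopic_words x (c @ p n) ([] @ [])" using Suc c null by (intro homotopic_words_append) auto
    then show ?case using Suc c unfolding s
      by (cases n) (auto simp: walk_append tight_append full_word_def)
  qed
  have ep: "x \<in> endpoints G" using x by (simp add: endpoints_def)
  obtain \<mu> C where mu: "\<mu> \<ge> 1" "C \<ge> 0" and
    qg: "\<And>\<gamma>. is_path G \<gamma> \<Longrightarrow> in_Gamma G (snd \<gamma>) \<Longrightarrow> reduced_word G (snd \<gamma>) \<Longrightarrow> quasi_geodesic_lifts G b \<mu> C \<gamma>"
    using beta unfolding beta_train_track_map_def by metis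
  \<comment> \<open>chosen to violate \<open>n \<le> \<mu> C\<close>\<close>
  define n where "n = Suc (nat \<lceil>\<mu> * C\<rceil>)"
  have w: "walk x (p n) x" "homotopic_words x (p n) []" "in_Gamma G (p n)" "tight (p n)" "full_word (p n)" using p by auto
  have "quasi_geodesic_lifts G b \<mu> C (x, p n)"
    using qg[of "(x, p n)"] Gamma_is_path[OF w(3,1,4) ep] reduced_word_tight[OF w(3,1)] w by simp
  moreover obtain q where q: "path q" "path_image q \<subseteq> G2 G" "pathfinish q = x" "path_class (G2 G) q \<in> covering_points G b x"
    using covering_points_nonempty walk_G2[OF w(1)] by blast
  ultimately have "simplicial_length (subword 0 (length (p n)) (p n)) / \<mu> - C \<le>
      covering_dist G (lift_end G (path_class (G2 G) q) (x, take 0 (p n)))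
        (lift_end G (path_class (G2 G) q) (x, take (length (p n)) (p n)))"
    unfolding quasi_geodesic_lifts_def Let_def by fastforce
  moreover have "walk x [] x" using w(1) by (auto dest: walk_G2)
  ultimately have "real (length (p n)) / \<mu> - C \<le> 0"
    using lift_end_null[OF w(1,2) q(1-3)] lift_end_null[of x "[]" q] homotopic_words_refl[of x "[]" x] q covering_dist_self[OF ep q(1-3)]
      simplicial_length_full[OF w(5)] by (simp add: subword_def)
  then have "real (length (p n)) \<le> \<mu> * C" using mu by (simp add: field_simps)
  moreover have "length (p n) \<ge> n" using p[of n] c(1) by (cases c) auto
  moreover have "real n > \<mu> * C" unfolding n_def using mu by (simp add: ) linarith
  ultimately show False by linarith
qed

text \<open>If \<open>z\<close> backtracks from its last segment \<open>t\<close> to its first segment \<open>s\<close>, conjugation by \<open>t\<close> moves \<open>t\<close> to the front, where it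
  merges with \<open>s\<close> and leaves a shorter loop. Otherwise the base point and all breakpoints are vertices, so \<open>z\<close> is a cyclically reduced
  loop of full edges. In particular a loop based inside an edge always falls under the first case.\<close>

lemma tight_not_null:
  assumes "z \<noteq> []" "walk x z x" "in_Gamma G z" "tight z" shows "\<not> homotopic_words x z []"
  using assms
proof (induction "length z" arbitrary: z x rule: less_induct)
  case less
  let ?s = "hd z" and ?t = "last z"
  have st: "valid_seg G ?s" "valid_seg G ?t" "seg_start G ?s = x" "seg_end G ?t = x"
    using less.prems walk_valid walk_successively[OF less.prems(2)] by auto
  show ?case
  proof (cases "backtrack ?t ?s")
    case False
    have ends: "snd (snd ?t) \<in> {0, 1}" "fst (snd ?s) \<in> {0, 1}"
      using seg_ends_at_vertex[OF st(2,1) _ False] st by auto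
    have "joined G z" using walk_joined[OF less.prems(2)] less.prems(4) by (simp add: tight_def)
    then have "full_word z"
      using joined_full_word[OF _ ends(2,1)] less.prems(4) by (simp add: tight_def)
    moreover have "x \<in> verts G"
      using edge_map_verts[of "fst ?s" "fst (snd ?s)"] ends(2) st(3) valid_segD(1)[OF st(1)] by (simp add: seg_start_def)
    ultimately show ?thesis using cyclically_reduced_not_null less.prems False by blast
  next
    case True
    have ns: "z \<noteq> [?s]"
    proof
      assume "z = [?s]"
      then have "?t = ?s" by (metis last.simps)
      moreover have "nontrivial_seg ?s" using less.prems(1,4) by (simp add: tight_def)
      ultimately show False using True by (simp add: backtrack_def nontrivial_seg_def)
    qed
    then have "z = hd z # tl z" "tl z \<noteq> []" using less.prems(1) by (cases z; simp)+
    then have "z = hd z # butlast (tl z) @ [last (tl z)]" by simp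
    then obtain s m t where z: "z = s # m @ [t]" by blast
    then have bt: "backtrack t s" using True by simp
    from less.prems(2) z obtain y y' where w: "seg_start G s = x" "valid_seg G s" "seg_end G s = y'"
      "walk y' m y" "valid_seg G t" "seg_start G t = y" "seg_end G t = x" "x \<in> G2 G"
      by (auto simp: walk_append)
    have y: "y \<in> G2 G" "y' \<in> G2 G" using walk_G2[OF w(4)] by auto
    let ?j = "join_segs t s"
    have j: "walk y ?j y'" "homotopic_words y [t, s] ?j" using valid_join_segs[OF w(5,2) bt] homotopic_words_join_segs[OF w(5,2) bt] w by auto
    have st': "\<not> backtrack s (hd (m @ [t]))" "tight (m @ [t])" "nontrivial_seg s"
      using less.prems(4) by (simp_all add: z tight_Cons)
    have nj: "?j @ m \<noteq> []"
    proof
      assume "?j @ m = []"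
      \<comment> \<open>for \<open>m = []\<close> the edge is a loop and \<open>t\<close>, \<open>s\<close> are parts of it; they could only cancel if \<open>z\<close> itself
        backtracked from \<open>s\<close> to \<open>t\<close>\<close>
      then have "m = []" "fst (snd t) = snd (snd s)" by (auto simp: join_segs_def split: if_splits)
      with st'(1) bt show False by (simp add: backtrack_def)
    qed
    have ltx: "length (?j @ m) < length z" by (simp add: z join_segs_def)
    have t: "tight (?j @ m)"
      using st' bt by (cases m) (auto simp: join_segs_def tight_Cons tight_append backtrack_def nontrivial_seg_def)
    have g: "in_Gamma G (?j @ m)" using less.prems(3) unfolding z by (auto simp: join_segs_def)
    have wj: "walk y (?j @ m) y" using j(1) w(4) by (auto simp: walk_append)
    from less.hyps[OF ltx nj wj g t] have nn: "\<not> homotopic_words y (?j @ m) []" .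
    show ?thesis
    proof
      assume null: "homotopic_words x z []"
      have tt: "walk y [t] x" "walk x [rev_seg t] y" "walk x [] x" "walk y [] y" "walk y' m y" "walk y [t, s] y'" "walk x [s] y'"
        using w y valid_segD(5)[OF w(5)] by auto
      have tsm: "walk y ([t, s] @ m) y" using tt(5,6) by (auto simp: walk_append)
      have tr: "walk y ([t] @ [rev_seg t]) y" using tt(1,2) by (auto simp: walk_append)
      have tz: "homotopic_words y ([t] @ z) ([t] @ [])" "walk y ([t] @ z) x"
        using homotopic_words_append[OF tt(1,1) homotopic_words_refl[OF tt(1)] less.prems(2) tt(3) null] tt(1) less.prems(2)
        by (auto simp: walk_append)
      have "homotopic_words y (?j @ m) ([t, s] @ m)"
        by (rule homotopic_words_append[OF j(1) tt(6) homotopic_words_sym[OF j(2)] tt(5,5) homotopic_words_refl[OF tt(5)]])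
      also have "homotopic_words y \<dots> (([t, s] @ m) @ [])"
        using homotopic_words_refl[OF tsm] by simp
      also have "homotopic_words y \<dots> (([t, s] @ m) @ ([t] @ [rev_seg t]))"
        using homotopic_words_rev_cancel[OF tt(1)]
        by (intro homotopic_words_append[OF tsm tsm homotopic_words_refl[OF tsm] tt(4) tr]) (simp add: homotopic_words_sym)
      also have "\<dots> = ([t] @ z) @ [rev_seg t]" by (simp add: z)
      also have "homotopic_words y \<dots> (([t] @ []) @ [rev_seg t])"
        using tt(1,3) by (intro homotopic_words_append[OF tz(2) _ tz(1) tt(2,2) homotopic_words_refl[OF tt(2)]]) simp
      also have "homotopic_words y \<dots> []" using homotopic_words_rev_cancel[OF tt(1)] by simp
      finally show False using nn by contradiction
    qed
  qed
qed

lemma tight_unique: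
  assumes "walk x v y" "walk x w y" "in_Gamma G v" "in_Gamma G w" "tight v" "tight w" "homotopic_words x v w"
  shows "v = w"
proof (rule tighten_rev_eq_Nil[OF assms(5,6)], rule ccontr)
  let ?z = "tighten (rev_word v) w"
  assume "?z \<noteq> []"
  have r: "walk y (rev_word v) x" by (rule walk_rev[OF assms(1)])
  have "tight ?z" using assms(6) walk_nontrivial[OF r] by (intro tight_tighten)
  moreover have "walk y ?z y" by (rule walk_tighten[OF r assms(2)])
  moreover have "in_Gamma G ?z" using assms by (intro in_Gamma_tighten) auto
  moreover have "homotopic_words y ?z []"
  proof -
    have "homotopic_words y ?z (rev_word v @ w)" by (rule homotopic_words_sym[OF homotopic_words_tighten[OF r assms(2)]])
    also have "homotopic_words y \<dots> (rev_word v @ v)" 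
      by (rule homotopic_words_append[OF r r homotopic_words_refl[OF r] assms(2,1) homotopic_words_sym[OF assms(7)]])
    also have "homotopic_words y \<dots> []" using homotopic_words_rev_cancel[OF r] by simp
    finally show ?thesis .
  qed
  ultimately show False using tight_not_null \<open>?z \<noteq> []\<close> by blast
qed

end


section \<open>Auxiliary edges and pre-INPs\<close>

text \<open>The loop is, up to reparametrisation, the image of a loop in the closed disk, which contracts along straight lines.\<close>

lemma null_homotopic_across_disk:
  fixes \<Phi> :: "complex \<Rightarrow> 'a::topological_space"
  assumes \<Phi>: "continuous_on (cball 0 1) \<Phi>" "\<Phi> ` cball 0 1 \<subseteq> S" and q: "path q" "path_image q \<subseteq> S"
    and par: "same_up_to_param (\<lambda>t. \<Phi> (cis (2 * pi * t + a))) q"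
  shows "homotopic_paths S q (\<lambda>_. pathstart q)"
proof -
  obtain \<phi> \<psi> :: "real \<Rightarrow> real" where p: "continuous_on {0..1} \<phi>" "mono_on {0..1} \<phi>" "\<phi> 0 = 0" "\<phi> 1 = 1"
    "continuous_on {0..1} \<psi>" "mono_on {0..1} \<psi>" "\<psi> 0 = 0" "\<psi> 1 = 1"
    and eq: "\<And>t. t \<in> {0..1} \<Longrightarrow> \<Phi> (cis (2 * pi * \<phi> t + a)) = q (\<psi> t)"
    using par unfolding same_up_to_param_def by metis
  have psi: "\<psi> \<in> {0..1} \<rightarrow> {0..1}"
    using mono_onD[OF p(6), of 0] mono_onD[OF p(6), of _ 1] p(7,8) by auto
  define g where "g t = cis (2 * pi * \<phi> t + a)" for t
  have g: "path g" "path_image g \<subseteq> cball 0 1" "pathstart g = cis a" "pathfinish g = cis a"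
    using p(1) by (auto simp: g_def path_def pathstart_def pathfinish_def path_image_def p intro!: continuous_intros)
      (simp add: cis_mult[symmetric])
  have "homotopic_paths (cball 0 1) g (\<lambda>_. cis a)"
  proof (rule homotopic_paths_linear)
    fix t :: real assume "t \<in> {0..1}"
    show "closed_segment (g t) (cis a) \<subseteq> cball 0 1"
      by (intro closed_segment_subset) (auto simp: g_def)
  qed (use g in auto)
  then have "homotopic_paths S (\<Phi> \<circ> g) (\<Phi> \<circ> (\<lambda>_. cis a))"
    using \<Phi> by (intro homotopic_paths_continuous_image) auto
  then have 1: "homotopic_paths S (\<Phi> \<circ> g) (\<lambda>_. pathstart q)"
    using eq[of 0] p by (simp add: o_def pathstart_def)
  have "homotopic_paths S q (\<Phi> \<circ> g)"
    by (rule homotopic_paths_reparametrize[OF q p(5) psi p(7,8)]) (simp add: g_def eq)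
  then show ?thesis using 1 by (rule homotopic_paths_trans)
qed

context nielsen_graph begin

lemma homotopic_words_rev:
  assumes "walk x u y" "walk x v y" "homotopic_words x u v" shows "homotopic_words y (rev_word u) (rev_word v)"
proof -
  note r = walk_rev[OF assms(1)] walk_rev[OF assms(2)]
  have n: "walk y [] y" using assms(1) by (auto dest: walk_G2)
  have vv: "walk x (v @ rev_word v) x" "walk y (rev_word u @ v) y" and uu: "walk y (rev_word u @ u) y"
    using assms r by (auto simp: walk_append)
  have x: "walk x [] x" using assms(1) by (auto dest: walk_G2)
  have "homotopic_words y (rev_word u @ []) (rev_word u @ (v @ rev_word v))"
    by (rule homotopic_words_append[OF r(1,1) homotopic_words_refl[OF r(1)] x vv(1) homotopic_words_sym[OF homotopic_words_rev_cancel[OF assms(2)]]])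
  also have "homotopic_words y \<dots> ((rev_word u @ u) @ rev_word v)"
    using homotopic_words_append[OF vv(2) uu homotopic_words_append[OF r(1,1) homotopic_words_refl[OF r(1)] assms(2,1) homotopic_words_sym[OF assms(3)]] r(2,2) homotopic_words_refl[OF r(2)]]
    by simp
  also have "homotopic_words y \<dots> ([] @ rev_word v)"
    using homotopic_words_rev_cancel[OF r(1)] assms(1) r(1)
    by (intro homotopic_words_append[OF _ n _ r(2,2) homotopic_words_refl[OF r(2)]]) (auto simp: walk_append)
  finally show ?thesis by simp
qed

text \<open>The substitutions meant are those of \<open>rhat\<close> and of the retraction, which replace each segment by a homotopic word.\<close>

lemma walk_substitute:
  assumes "\<And>s. valid_seg G s \<Longrightarrow> walk (seg_start G s) (\<phi> s) (seg_end G s) \<and> homotopic_words (seg_start G s) [s] (\<phi> s)"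
    and "walk x w y"
  shows "walk x (concat (map \<phi> w)) y" "homotopic_words x w (concat (map \<phi> w))"
proof -
  have "walk x (concat (map \<phi> w)) y \<and> homotopic_words x w (concat (map \<phi> w))"
    using assms(2)
  proof (induction w arbitrary: x)
    case Nil from homotopic_words_refl[OF this] Nil show ?case by auto
  next
    case (Cons s w)
    then have s: "valid_seg G s" "seg_start G s = x" "walk (seg_end G s) w y" by auto
    have s1: "walk x [s] (seg_end G s)" using s walk_G2[OF s(3)] by simp
    note IH = Cons.IH[OF s(3)] and p = assms(1)[OF s(1), unfolded s(2)]
    have "homotopic_words x ([s] @ w) (\<phi> s @ concat (map \<phi> w))"
      using IH p by (intro homotopic_words_append[OF s1 _ _ s(3)]) auto
    then show ?case using IH p by (auto simp: walk_append)
  qed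
  then show "walk x (concat (map \<phi> w)) y" "homotopic_words x w (concat (map \<phi> w))" by auto
qed

lemma aux_seg_cases:
  assumes "valid_seg G s" "fst s \<in> aux G"
  obtains "s = (fst s, 0, 1)" | "s = (fst s, 1, 0)"
  using valid_segD(6)[OF assms(1)] assms(2) aux_disjoint by (auto simp: full_seg_def prod_eq_iff)

lemma vertex_params:
  assumes "valid_seg G s"
  shows "seg_start G s \<in> verts G \<Longrightarrow> fst (snd s) \<in> {0, 1}" "seg_end G s \<in> verts G \<Longrightarrow> snd (snd s) \<in> {0, 1}"
proof -
  have "a \<in> {0, 1}" if "e \<in> hat G" "a \<in> {0..1}" "emap G e a \<in> verts G" for e a
  proof (rule ccontr)
    assume "a \<notin> {0, 1}"
    then have "emap G e a \<in> open_edge G e" using that(2) by (auto simp: open_edge_def)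
    moreover have "open_edge G e \<inter> (verts G \<union> aux_verts G) = {}"
      using that(1) cell by (auto simp: cell_complex_def cells1_def)
    ultimately show False using that(3) by blast
  qed
  then show "seg_start G s \<in> verts G \<Longrightarrow> fst (snd s) \<in> {0, 1}" "seg_end G s \<in> verts G \<Longrightarrow> snd (snd s) \<in> {0, 1}"
    using assms by (auto simp: valid_seg_def full_seg_def seg_start_def seg_end_def edge_map_eq; blast)+
qed

lemma tight_rev_word: "tight (rev_word w) \<longleftrightarrow> tight w"
proof -
  have "successively (\<lambda>s t. \<not> backtrack s t) (rev_word w) \<longleftrightarrow> successively (\<lambda>s t. \<not> backtrack s t) w"
    unfolding rev_word_def successively_rev successively_map by (rule successively_cong) (auto simp: backtrack_def)
  then show ?thesis by (auto simp: tight_def set_rev_word)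
qed

text \<open>On full segments, backtracking means being inverse to each other, so both reductions agree.\<close>

lemma free_reduce_tighten: "full_word w \<Longrightarrow> free_reduce w = tighten w [] \<and> full_word (free_reduce w)"
proof (induction w)
  case (Cons s w)
  then have IH: "free_reduce w = tighten w []" "full_word (free_reduce w)" and s: "full_seg s"
    by (auto simp: full_word_def)
  have "cancel_seg s u = push s u \<and> full_word (cancel_seg s u)" if "full_word u" for u
  proof (cases u)
    case (Cons t u')
    then have "full_seg t" using that by (simp add: full_word_def)
    then have "t = rev_seg s \<longleftrightarrow> backtrack s t" "t = rev_seg s \<Longrightarrow> join_segs s t = []"
      using s by (auto simp: full_seg_def backtrack_def rev_seg_def join_segs_def prod_eq_iff)
    then show ?thesis using that s by (auto simp: Cons cancel_seg_def push_def full_word_def)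
  qed (use s in \<open>auto simp: cancel_seg_def push_def full_word_def\<close>)
  from this[OF IH(2)] IH show ?case by (auto simp: free_reduce_def)
qed (simp add: free_reduce_def full_word_def)

end

context beta_map begin

lemma nielsen: "nielsen_faces G f" and retraction: "retraction_structure G"
  using beta by (simp_all add: beta_train_track_map_def partial_train_track_map_def)

lemma valid_aux_seg: "e \<in> aux G \<Longrightarrow> valid_seg G (e, 0, 1)" "e \<in> aux G \<Longrightarrow> valid_seg G (e, 1, 0)"
  by (simp_all add: valid_seg_def full_seg_def)

text \<open>The INP begins and ends at vertices, hence consists of full edges. The boundary of the Nielsen face is the loop
  \<open>inp e\<close> preceded by the reverse of \<open>e\<close>, which is therefore null-homotopic; for the redundant faces at a tripod the homotopy is part of
  the structure.\<close>

lemma inp_walk: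
  assumes "e \<in> aux G"
  shows "walk (edge_map G e 0) (inp G e) (edge_map G e 1)" "full_word (inp G e)"
    "homotopic_words (edge_map G e 0) [(e, 0, 1)] (inp G e)"
proof -
  let ?w = "inp G e" and ?x = "edge_map G e 0" and ?y = "edge_map G e 1"
  have inp: "INP G f ?w" "seg_start G (hd ?w) = ?x" "seg_end G (last ?w) = ?y"
    and face: "nielsen_face G e \<or> homotopic_paths (G2 G) (edge_map G e) (realize G (word_path G ?w))"
    using nielsen assms unfolding nielsen_faces_def by blast+
  have ip: "is_path G (?x, ?w)" "?w \<noteq> []" using inp by (auto simp: INP_def word_path_def)
  from is_path_walk[OF ip(1)] obtain y where "walk ?x ?w y" .
  with walk_successively(3)[OF this ip(2)] inp(3) show w: "walk ?x ?w ?y" by simp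
  have xy: "?x \<in> verts G" "?y \<in> verts G" using assms by (auto intro: edge_map_verts)
  have "fst (snd (hd ?w)) \<in> {0, 1}" "snd (snd (last ?w)) \<in> {0, 1}"
    using walk_valid[OF w] ip(2) inp(2,3) xy vertex_params by auto
  then show "full_word ?w" using ip(1) walk_nontrivial[OF w] by (intro joined_full_word) (auto simp: is_path_def)
  let ?s = "(e, 0::real, 1::real)"
  have s: "seg_start G ?s = ?x" "seg_end G ?s = ?y" "rev_seg ?s = (e, 1, 0)"
    by (simp_all add: seg_start_def seg_end_def rev_seg_def)
  have ws: "walk ?x [?s] ?y" "walk ?y [(e, 1, 0)] ?x"
    using valid_aux_seg[OF assms] walk_G2[OF w] by (simp_all add: seg_start_def seg_end_def)
  show "homotopic_words ?x [?s] ?w"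
    using face
  proof
    assume "homotopic_paths (G2 G) (edge_map G e) (realize G (word_path G ?w))"
    then show ?thesis using track_single[OF valid_aux_seg(1)[OF assms]] inp(2)
      by (auto simp: homotopic_words_def s realize_def word_path_def intro: homotopic_paths_trans simp del: track.simps)
  next
    assume "nielsen_face G e"
    then obtain \<Phi> a where \<Phi>: "\<Phi> \<in> faces G"
      and par: "same_up_to_param (\<lambda>t. \<Phi> (cis (2 * pi * t + a))) (realize G (word_path G ((e, 1, 0) # ?w)))"
      unfolding nielsen_face_def by blast
    have wl: "walk ?y ((e, 1, 0) # ?w) ?y" using ws(2) w by (simp add: seg_end_def)
    have "homotopic_paths (G2 G) (track G ?y ((e, 1, 0) # ?w)) (\<lambda>_. pathstart (track G ?y ((e, 1, 0) # ?w)))"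
    proof (rule null_homotopic_across_disk)
      show "continuous_on (cball 0 1) \<Phi>" using \<Phi> cell by (auto simp: cell_complex_def)
      show "\<Phi> ` cball 0 1 \<subseteq> G2 G" using \<Phi> by (auto simp: G2_def)
      show "same_up_to_param (\<lambda>t. \<Phi> (cis (2 * pi * t + a))) (track G ?y ((e, 1, 0) # ?w))"
        using par by (simp add: realize_def word_path_def seg_start_def)
    qed (rule path_track[OF wl])+
    then have null: "homotopic_words ?y ((e, 1, 0) # ?w) []"
      unfolding homotopic_words_def path_track(3)[OF wl] by simp
    have "homotopic_words ?x ([?s] @ []) ([?s] @ ((e, 1, 0) # ?w))"
      using wl walk_G2[OF wl] by (intro homotopic_words_append[OF ws(1,1) homotopic_words_refl[OF ws(1)] _ wl homotopic_words_sym[OF null]]) simp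
    also have "\<dots> = ([?s] @ rev_word [?s]) @ ?w" by (simp add: s)
    also have "homotopic_words ?x \<dots> ([] @ ?w)"
      using homotopic_words_rev_cancel[OF ws(1)] ws w walk_G2[OF w]
      by (intro homotopic_words_append[OF _ _ _ w w homotopic_words_refl[OF w]]) (auto simp: s walk_append)
    finally show ?thesis by simp
  qed
qed

text \<open>A homotopy for an auxiliary edge traversed forwards serves, reversed, for the same edge traversed backwards.\<close>

lemma oriented_expansion:
  assumes e: "fst s \<in> aux G" "valid_seg G s"
    and v: "walk (edge_map G (fst s) 0) v (edge_map G (fst s) 1)" "homotopic_words (edge_map G (fst s) 0) [(fst s, 0, 1)] v"
  defines "w \<equiv> if fst (snd s) < snd (snd s) then v else rev_word v"
  shows "walk (seg_start G s) w (seg_end G s)" "homotopic_words (seg_start G s) [s] w"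
proof -
  let ?e = "fst s"
  have 1: "walk (edge_map G ?e 0) [(?e, 0, 1)] (edge_map G ?e 1)"
    using valid_aux_seg[OF e(1)] walk_G2[OF v(1)] by (simp add: seg_start_def seg_end_def)
  have "walk (seg_start G s) w (seg_end G s) \<and> homotopic_words (seg_start G s) [s] w"
    using e(2,1)
  proof (cases rule: aux_seg_cases)
    case 1
    then have "fst (snd s) = 0" "snd (snd s) = 1" by (metis fst_conv snd_conv)+
    then show ?thesis using v by (subst (4) 1) (simp add: w_def seg_start_def seg_end_def)
  next
    case 2
    then have "fst (snd s) = 1" "snd (snd s) = 0" by (metis fst_conv snd_conv)+
    then show ?thesis using walk_rev[OF v(1)] homotopic_words_rev[OF 1 v] by (subst (4) 2) (simp add: w_def seg_start_def seg_end_def rev_seg_def)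
  qed
  then show "walk (seg_start G s) w (seg_end G s)" "homotopic_words (seg_start G s) [s] w" by auto
qed

lemma homotopic_words_single: "valid_seg G s \<Longrightarrow> walk (seg_start G s) [s] (seg_end G s) \<and> homotopic_words (seg_start G s) [s] [s]"
  using homotopic_words_refl[of "seg_start G s" "[s]" "seg_end G s"] seg_G2 by simp

lemma rhat_seg_homotopic:
  assumes "valid_seg G s"
  shows "walk (seg_start G s) (rhat_seg G s) (seg_end G s) \<and> homotopic_words (seg_start G s) [s] (rhat_seg G s)"
  using oriented_expansion[OF _ assms inp_walk(1) inp_walk(3)] homotopic_words_single[OF assms] by (simp add: rhat_seg_def)

lemma full_word_rev: "full_word (rev_word w) \<longleftrightarrow> full_word w"
  by (auto simp: full_word_def set_rev_word full_seg_def rev_seg_def prod_eq_iff)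

lemma rhat_word_full: "full_word w \<Longrightarrow> full_word (rhat_word G w)"
proof (induction w)
  case (Cons s w)
  then have "full_word (rhat_seg G s)"
    by (auto simp: rhat_seg_def inp_walk(2) full_word_rev) (simp_all add: full_word_def)
  with Cons show ?case by (auto simp: rhat_word_def full_word_def)
qed (simp add: rhat_word_def full_word_def)

text \<open>The pre-INP arises from the auxiliary edge by repeatedly replacing auxiliary edges by their INPs and a final
  free reduction, and no step leaves the homotopy class.\<close>

lemma pre_INP_walk:
  assumes "e \<in> aux G"
  shows "walk (edge_map G e 0) (pre_INP G e) (edge_map G e 1)" "homotopic_words (edge_map G e 0) [(e, 0, 1)] (pre_INP G e)"
    "tight (pre_INP G e)" "in_Gamma G (pre_INP G e)"
proof -
  let ?x = "edge_map G e 0" and ?y = "edge_map G e 1" and ?s = "(e, 0::real, 1::real)"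
  have 1: "walk ?x [?s] ?y"
    using valid_aux_seg(1)[OF assms] seg_G2(2)[OF valid_aux_seg(1)[OF assms]] by (simp add: seg_start_def seg_end_def)
  have it: "walk ?x ((rhat_word G ^^ n) [?s]) ?y \<and> homotopic_words ?x [?s] ((rhat_word G ^^ n) [?s]) \<and> full_word ((rhat_word G ^^ n) [?s])" for n
  proof (induction n)
    case 0 then show ?case using 1 homotopic_words_refl[OF 1] walk_G2[OF 1] by (simp add: full_word_def full_seg_def)
  next
    case (Suc n)
    let ?u = "(rhat_word G ^^ n) [?s]"
    have "walk ?x (rhat_word G ?u) ?y" "homotopic_words ?x ?u (rhat_word G ?u)"
      using walk_substitute[of "rhat_seg G", OF rhat_seg_homotopic, of ?x ?u ?y] Suc unfolding rhat_word_def by blast+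
    then show ?case using Suc rhat_word_full by (simp del: One_nat_def) (blast intro: homotopic_words_trans)
  qed
  let ?w = "(rhat_word G ^^ rpow G) [?s]"
  have w: "walk ?x ?w ?y" "homotopic_words ?x [?s] ?w" "full_word ?w" using it by auto
  have p: "pre_INP G e = tighten ?w []" using free_reduce_tighten[OF w(3)] by (simp add: pre_INP_def)
  have n: "walk ?y [] ?y" using walk_G2[OF w(1)] by simp
  show "walk ?x (pre_INP G e) ?y" unfolding p using w(1) n by (rule walk_tighten)
  show "homotopic_words ?x [?s] (pre_INP G e)" unfolding p using homotopic_words_tighten[OF w(1) n] w(2) by (simp add: homotopic_words_trans)
  show "tight (pre_INP G e)" unfolding p using walk_nontrivial[OF w(1)] by (simp add: tight_tighten)
  have "in_Gamma G ?w" using retraction assms by (auto simp: retraction_structure_def)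
  then show "in_Gamma G (pre_INP G e)" unfolding p by (intro in_Gamma_tighten) auto
qed

lemma ret_seg_homotopic:
  assumes "valid_seg G s"
  shows "walk (seg_start G s) (ret_seg G s) (seg_end G s) \<and> homotopic_words (seg_start G s) [s] (ret_seg G s)"
  using oriented_expansion[OF _ assms pre_INP_walk(1,2)] homotopic_words_single[OF assms] by (simp add: ret_seg_def)

lemma ret_seg_Gamma:
  assumes "valid_seg G s" shows "in_Gamma G (ret_seg G s)" "tight (ret_seg G s)"
  using pre_INP_walk(3,4)[of "fst s"] valid_segD(1,4)[OF assms]
  by (auto simp: ret_seg_def tight_rev_word tight_Cons)

lemma ret_word_homotopic:
  assumes "walk x w y" shows "walk x (ret_word G w) y" "homotopic_words x w (ret_word G w)" "in_Gamma G (ret_word G w)"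
proof -
  show "walk x (ret_word G w) y" "homotopic_words x w (ret_word G w)"
    using walk_substitute[of "ret_seg G", OF ret_seg_homotopic assms] by (simp_all add: ret_word_def)
  have "\<forall>s\<in>set w. in_Gamma G (ret_seg G s)"
    using walk_valid[OF assms] ret_seg_Gamma(1) by blast
  then show "in_Gamma G (ret_word G w)" by (induction w) (simp_all add: ret_word_def)
qed

end


section \<open>Collapsing the relative part to a circle\<close>

text \<open>A continuous map from a compact space to a Hausdorff space is closed, hence a quotient map onto its image.\<close>

lemma continuous_on_image_compact:
  fixes g :: "'a::t2_space \<Rightarrow> 'b::t2_space" and k :: "'b \<Rightarrow> 'c::topological_space"
  assumes "compact K" "continuous_on K g" "continuous_on K (k \<circ> g)" shows "continuous_on (g ` K) k"
  unfolding continuous_on_closed_invariant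
proof (intro allI impI)
  fix C :: "'c set" assume C: "closed C"
  let ?P = "(k \<circ> g) -` C \<inter> K"
  obtain A where "closed A" "A \<inter> K = ?P"
    using assms(3) C unfolding continuous_on_closed_invariant by metis
  then have "compact ?P" using assms(1) by (metis closed_Int_compact)
  moreover have "continuous_on ?P g" using assms(2) by (rule continuous_on_subset) blast
  ultimately have "closed (g ` ?P)" by (intro compact_imp_closed compact_continuous_image)
  moreover have "g ` ?P \<inter> g ` K = k -` C \<inter> g ` K" by auto
  ultimately show "\<exists>A. closed A \<and> A \<inter> g ` K = k -` C \<inter> g ` K" by blast
qed

context nielsen_graph begin

text \<open>The map to the unit circle that runs once around it along the open edge \<open>h\<close> and sends everything else to
  \<open>1\<close>. It is used on the relative part only, for half-edges \<open>h\<close>.\<close>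

definition circle_map :: "'e \<Rightarrow> 'a \<Rightarrow> complex" where
  "circle_map h y = (if y \<in> open_edge G h then cis (2 * pi * (THE t. t \<in> {0<..<1} \<and> emap G h t = y)) else 1)"

lemma half_ends: "h \<in> half G \<Longrightarrow> emap G h 0 \<in> verts G" "h \<in> half G \<Longrightarrow> emap G h 1 \<in> aux_verts G"
  using cell by (auto simp: cell_complex_def)

lemma circle_map_vertex: "h \<in> half G \<Longrightarrow> y \<in> verts G \<union> aux_verts G \<Longrightarrow> circle_map h y = 1"
  using cell by (auto simp: cell_complex_def cells1_def circle_map_def)

lemma circle_map_own:
  assumes "h \<in> half G" "t \<in> {0..1}" shows "circle_map h (emap G h t) = cis (2 * pi * t)"
proof (cases "t \<in> {0<..<1}")
  case True
  have "inj_on (emap G h) {0<..<1}" using assms(1) cell by (auto simp: cell_complex_def cells1_def)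
  then have "(THE t'. t' \<in> {0<..<1} \<and> emap G h t' = emap G h t) = t"
    using True by (intro the_equality) (auto dest: inj_onD)
  then show ?thesis using True by (auto simp: circle_map_def open_edge_def)
next
  case False
  with assms(2) have "t = 0 \<or> t = 1" by auto
  then show ?thesis using circle_map_vertex[OF assms(1)] half_ends[OF assms(1)] by auto
qed

lemma circle_map_other:
  assumes "h \<in> half G" "e \<in> gam G \<union> half G" "e \<noteq> h" "t \<in> {0..1}" shows "circle_map h (emap G e t) = 1"
proof (cases "t \<in> {0<..<1}")
  case True
  then have "emap G e t \<in> open_edge G e" by (auto simp: open_edge_def)
  moreover have "open_edge G e \<inter> open_edge G h = {}"
    using assms cell by (auto simp: cell_complex_def cells1_def)
  ultimately show ?thesis by (auto simp: circle_map_def)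
next
  case False
  with assms(4) have "t = 0 \<or> t = 1" by auto
  moreover have "emap G e 0 \<in> verts G \<union> aux_verts G" "emap G e 1 \<in> verts G \<union> aux_verts G"
    using assms(2) cell by (auto simp: cell_complex_def)
  ultimately show ?thesis using circle_map_vertex[OF assms(1)] by auto
qed

text \<open>The relative part is the union of the closed edge \<open>h\<close> and of the finitely many other closed cells, and on the
  latter the map is constant.\<close>

lemma continuous_on_circle_map:
  assumes "h \<in> half G" shows "continuous_on (rel_part G) (circle_map h)"
proof -
  let ?K = "emap G h ` {0..1}" and ?E = "(gam G \<union> half G) - {h}"
  let ?R = "verts G \<union> aux_verts G \<union> (\<Union>e\<in>?E. emap G e ` {0..1})"
  have cont: "continuous_on {0..1} (emap G e)" if "e \<in> gam G \<union> half G" for e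
    using that cell by (auto simp: cell_complex_def cells1_def)
  have closed: "closed (emap G e ` {0..1})" if "e \<in> gam G \<union> half G" for e
    using cont[OF that] by (intro compact_imp_closed compact_continuous_image) auto
  have fin: "finite ?E" "finite (verts G)" "finite (aux_verts G)"
    using cell by (auto simp: cell_complex_def cells1_def)
  have "continuous_on {0..1} (circle_map h \<circ> emap G h)"
    by (subst continuous_on_cong[OF refl, of _ _ "\<lambda>t. cis (2 * pi * t)"])
       (auto simp: circle_map_own[OF assms] intro!: continuous_intros)
  then have 1: "continuous_on ?K (circle_map h)"
    using cont assms by (intro continuous_on_image_compact) auto
  have "circle_map h y = 1" if "y \<in> ?R" for y
  proof (cases "y \<in> verts G \<union> aux_verts G")
    case False
    with that obtain e t where "e \<in> gam G \<union> half G" "e \<noteq> h" "t \<in> {0..1}" "y = emap G e t" by blast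
    with circle_map_other[OF assms] show ?thesis by blast
  qed (rule circle_map_vertex[OF assms])
  then have 2: "continuous_on ?R (circle_map h)"
    by (subst continuous_on_cong[OF refl, of _ _ "\<lambda>_. 1"]) auto
  have clR: "closed ?R" using fin closed by (intro closed_Un closed_UN finite_imp_closed) auto
  have "continuous_on (?K \<union> ?R) (circle_map h)"
    using closed assms by (intro continuous_on_closed_Un[OF _ clR 1 2]) simp
  moreover have "?K \<union> ?R = rel_part G" using assms by (auto simp: rel_part_def)
  ultimately show ?thesis by simp
qed

lemma circle_map_norm: "circle_map h y \<noteq> 0"
  by (simp add: circle_map_def)

text \<open>For loops, the algebraic number of times that \<open>p\<close> traverses the edge \<open>h\<close>.\<close>

definition crossing :: "'e \<Rightarrow> (real \<Rightarrow> 'a) \<Rightarrow> complex" where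
  "crossing h p = winding_number (circle_map h \<circ> p) 0"

lemma circle_path:
  assumes "h \<in> half G" "path p" "path_image p \<subseteq> rel_part G"
  shows "path (circle_map h \<circ> p)" "0 \<notin> path_image (circle_map h \<circ> p)"
proof -
  have "continuous_on (p ` {0..1}) (circle_map h)"
    using continuous_on_circle_map[OF assms(1)] assms(3) by (auto simp: path_image_def elim: continuous_on_subset)
  then show "path (circle_map h \<circ> p)"
    using assms(2) unfolding path_def by (intro continuous_on_compose)
  show "0 \<notin> path_image (circle_map h \<circ> p)"
    unfolding path_image_def using circle_map_norm[of h] by (metis comp_apply imageE)
qed

lemma crossing_homotopic:
  assumes "h \<in> half G" "homotopic_paths (rel_part G) p q" shows "crossing h p = crossing h q"
  unfolding crossing_def
  using continuous_on_circle_map[OF assms(1)] circle_map_norm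
  by (intro winding_number_homotopic_paths homotopic_paths_continuous_image[OF assms(2)]) auto

lemma crossing_join:
  assumes "h \<in> half G" "path p" "path_image p \<subseteq> rel_part G" "path q" "path_image q \<subseteq> rel_part G" "pathfinish p = pathstart q"
  shows "crossing h (p +++ q) = crossing h p + crossing h q"
  using circle_path[OF assms(1-3)] circle_path[OF assms(1,4,5)] assms(6)
  by (simp add: crossing_def path_compose_join winding_number_join pathfinish_compose pathstart_compose)

lemma crossing_reversepath:
  assumes "h \<in> half G" "path p" "path_image p \<subseteq> rel_part G"
  shows "crossing h (reversepath p) = - crossing h p"
  using circle_path[OF assms] by (simp add: crossing_def path_compose_reversepath winding_number_reversepath)

lemma crossing_const: "crossing h (\<lambda>_. x) = 0"
  using circle_map_norm[of h x] by (auto simp: crossing_def intro: winding_number_constI)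

lemma crossing_half:
  assumes "h \<in> half G" "e \<in> half G" shows "crossing h (emap G e) = (if e = h then 1 else 0)"
proof (cases "e = h")
  case True
  have "winding_number (circle_map h \<circ> emap G h) 0 = winding_number (circlepath 0 1) 0"
    by (rule winding_number_cong) (simp add: circle_map_own[OF assms(1)] circlepath cis_conv_exp mult_ac)
  also have "\<dots> = 1" by (simp add: winding_number_circlepath_centre)
  finally show ?thesis using True by (simp add: crossing_def)
next
  case False
  then show ?thesis using assms circle_map_other[OF assms(1), of e]
    by (auto simp: crossing_def intro!: winding_number_constI[of 1])
qed

lemma half_path: "h \<in> half G \<Longrightarrow> path (emap G h)" "h \<in> half G \<Longrightarrow> path_image (emap G h) \<subseteq> rel_part G"
  using emap_path by (auto simp: cells1_def rel_part_def path_image_def)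

lemma crossing_aux:
  assumes "h \<in> half G" "e \<in> aux G"
  shows "crossing h (edge_map G e) =
    (if h = fst (legs G e) then 1 else 0) - (if h = snd (legs G e) then 1 else 0)"
  using assms legs_half[OF assms(2)] half_path
  by (auto simp: edge_map_def crossing_join crossing_reversepath crossing_half pathfinish_def pathstart_reversepath)

definition seg_path :: "'e seg \<Rightarrow> real \<Rightarrow> 'a" where
  "seg_path s = sub_path (fst (snd s)) (snd (snd s)) (edge_map G (fst s))"

lemma seg_path_aux:
  assumes "valid_seg G s" "fst s \<in> aux G"
  shows "path (seg_path s)" "path_image (seg_path s) \<subseteq> rel_part G"
    "pathstart (seg_path s) = seg_start G s" "pathfinish (seg_path s) = seg_end G s"
  using edge_map_path[OF valid_segD(1)[OF assms(1)]] edge_map_rel_part[of "fst s"] assms(2)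
    path_image_sub_path[of "fst (snd s)" "snd (snd s)" "edge_map G (fst s)"] valid_segD(2,3)[OF assms(1)]
  by (auto simp: seg_path_def seg_start_def seg_end_def intro: path_sub_path)

lemma crossing_seg:
  assumes "h \<in> half G" "valid_seg G s" "fst s \<in> aux G"
  shows "crossing h (seg_path s) = (if fst (snd s) < snd (snd s) then 1 else - 1) *
    ((if h = fst (legs G (fst s)) then 1 else 0) - (if h = snd (legs G (fst s)) then 1 else 0))"
  using assms(2,3)
proof (cases rule: aux_seg_cases)
  case 1
  then have "fst (snd s) = 0" "snd (snd s) = 1" by (metis fst_conv snd_conv)+
  then show ?thesis using crossing_aux[OF assms(1,3)] by (simp add: seg_path_def)
next
  case 2
  then have "fst (snd s) = 1" "snd (snd s) = 0" by (metis fst_conv snd_conv)+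
  then have "seg_path s = reversepath (edge_map G (fst s))"
    using reversepath_sub_path[of 0 1 "edge_map G (fst s)"] by (simp add: seg_path_def)
  moreover have "path (edge_map G (fst s))" "path_image (edge_map G (fst s)) \<subseteq> rel_part G"
    using edge_map_path edge_map_rel_part assms(3) by auto
  ultimately show ?thesis using crossing_aux[OF assms(1,3)] crossing_reversepath[OF assms(1)] \<open>fst (snd s) = 1\<close> \<open>snd (snd s) = 0\<close>
    by simp
qed

end

context beta_map begin

text \<open>The component of the relative part through \<open>x\<close> is one of the vertex spaces, whose fundamental group injects.
  The condition speaks of loops at the base point of the marking, hence the connecting path \<open>\<sigma>\<close>.\<close>

lemma null_in_rel_part:
  assumes p: "path p" "path_image p \<subseteq> rel_part G" "pathstart p = x" "pathfinish p = x"
    and null: "homotopic_paths (G2 G) p (\<lambda>_. x)"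
  shows "homotopic_paths (rel_part G) p (\<lambda>_. x)"
proof -
  let ?V = "connected_component_set (rel_part G) x"
  have xp: "x \<in> path_image p" using p(3) by auto
  then have x: "x \<in> rel_part G" using p(2) by blast
  have V: "?V \<in> components (rel_part G)" using x by (rule componentsI)
  have "path_image p \<subseteq> ?V" using xp p(1,2) by (intro connected_component_maximal connected_path_image)
  then have l: "p \<in> loops_at ?V x" "(\<lambda>_. x) \<in> loops_at ?V x" "x \<in> ?V"
    using p xp by (auto simp: loops_at_def)
  have "b \<in> G2 G" using beta by (simp add: beta_train_track_map_def represents_def)
  moreover have "path_connected (G2 G)" using cell by (simp add: cell_complex_def)
  moreover have "x \<in> G2 G" using x rel_part_G2 by blast
  ultimately have "\<exists>\<sigma>. path \<sigma> \<and> path_image \<sigma> \<subseteq> G2 G \<and> pathstart \<sigma> = b \<and> pathfinish \<sigma> = x"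
    by (simp add: path_connected_def)
  then obtain \<sigma> where s: "path \<sigma>" "path_image \<sigma> \<subseteq> G2 G" "pathstart \<sigma> = b" "pathfinish \<sigma> = x" by (elim exE conjE)
  have hp: "homotopic_paths (G2 G) (\<sigma> +++ p +++ reversepath \<sigma>) (\<sigma> +++ (\<lambda>_. x) +++ reversepath \<sigma>)"
    using s p null by (intro homotopic_paths_join) auto
  have "path_class (G2 G) (\<sigma> +++ p +++ reversepath \<sigma>) = path_class (G2 G) (\<sigma> +++ (\<lambda>_. x) +++ reversepath \<sigma>)"
    unfolding path_class_def
    using homotopic_paths_trans[OF hp] homotopic_paths_trans[OF homotopic_paths_sym[OF hp]] by (intro Collect_cong) blast
  then have eq: "\<theta> (path_class (G2 G) (\<sigma> +++ p +++ reversepath \<sigma>)) =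
    \<theta> (path_class (G2 G) (\<sigma> +++ (\<lambda>_. x) +++ reversepath \<sigma>))" by simp
  have vsc: "vertex_space_condition G F B \<alpha> b \<theta>" using beta by (simp add: beta_train_track_map_def)
  have "path \<sigma> \<and> path_image \<sigma> \<subseteq> G2 G \<and> pathstart \<sigma> = b \<and> pathfinish \<sigma> = x" using s by simp
  note inj = conjunct1[OF mp[OF spec[OF bspec[OF bspec[OF vsc[unfolded vertex_space_condition_def] V] l(3)]] this]]
  have "homotopic_paths ?V p (\<lambda>_. x)" by (rule mp[OF bspec[OF bspec[OF inj l(1)] l(2)] eq])
  then show ?thesis by (rule homotopic_paths_subset) (rule connected_component_subset)
qed

lemma homotopic_words_single_seg_path:
  assumes "valid_seg G s" shows "homotopic_paths (G2 G) (track G (seg_start G s) [s]) (seg_path s)"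
  unfolding seg_path_def by (rule track_single[OF assms])

text \<open>An auxiliary edge traverses its first half-edge exactly once.\<close>

lemma aux_not_null:
  assumes s: "valid_seg G s" "fst s \<in> aux G" and closed: "seg_end G s = seg_start G s"
  shows "\<not> homotopic_words (seg_start G s) [s] []"
proof
  assume null: "homotopic_words (seg_start G s) [s] []"
  let ?h = "fst (legs G (fst s))"
  note h = legs_half[OF s(2)]
  have "homotopic_paths (G2 G) (seg_path s) (\<lambda>_. seg_start G s)"
    using homotopic_paths_trans[OF homotopic_paths_sym[OF homotopic_words_single_seg_path[OF s(1)]]] null by (simp add: homotopic_words_def)
  then have "homotopic_paths (rel_part G) (seg_path s) (\<lambda>_. seg_start G s)"
    using seg_path_aux[OF s] closed by (intro null_in_rel_part) auto
  from crossing_homotopic[OF h(1) this] crossing_seg[OF h(1) s] h(3) show False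
    by (simp add: crossing_const split: if_splits)
qed

text \<open>By \<open>crossing_homotopic\<close>, \<open>s\<close> and \<open>t\<close> cross every half-edge equally often. So their legs form the same set, which
  determines the auxiliary edge, and the signs of the crossings determine the orientation.\<close>

lemma aux_homotopic_unique:
  assumes s: "valid_seg G s" "fst s \<in> aux G" and t: "valid_seg G t" "fst t \<in> aux G"
    and ends: "seg_start G t = seg_start G s" "seg_end G t = seg_end G s"
    and homotopic: "homotopic_words (seg_start G s) [s] [t]"
  shows "s = t"
proof -
  let ?p = "seg_path s +++ reversepath (seg_path t)"
  note ps = seg_path_aux[OF s] and pt = seg_path_aux[OF t]
  have sub: "path_image (seg_path s) \<subseteq> G2 G" "path_image (seg_path t) \<subseteq> G2 G"
    using ps(2) pt(2) rel_part_G2 by auto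
  have "homotopic_paths (G2 G) (seg_path s) (track G (seg_start G s) [s])"
    by (rule homotopic_paths_sym[OF homotopic_words_single_seg_path[OF s(1)]])
  also have "homotopic_paths (G2 G) \<dots> (track G (seg_start G s) [t])"
    using homotopic by (simp add: homotopic_words_def)
  also have "homotopic_paths (G2 G) \<dots> (seg_path t)"
    using homotopic_words_single_seg_path[OF t(1)] ends(1) by simp
  finally have "homotopic_paths (G2 G) ?p (seg_path t +++ reversepath (seg_path t))"
    using ps pt sub ends by (intro homotopic_paths_join) auto
  also have "homotopic_paths (G2 G) \<dots> (\<lambda>_. seg_start G s)"
    using pt sub ends by (intro homotopic_paths_join_reverse) auto
  finally have "homotopic_paths (rel_part G) ?p (\<lambda>_. seg_start G s)"
    using ps pt ends path_image_join_subset[of "seg_path s" "reversepath (seg_path t)"]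
    by (intro null_in_rel_part) auto
  then have eq: "crossing h (seg_path s) = crossing h (seg_path t)" if "h \<in> half G" for h
    using crossing_homotopic[OF that] crossing_join[OF that ps(1,2), of "reversepath (seg_path t)"]
      crossing_reversepath[OF that pt(1,2)] pt ps ends by (simp add: crossing_const)
  note hs = legs_half[OF s(2)] and ht = legs_half[OF t(2)]
  have 1: "fst (legs G (fst s)) = fst (legs G (fst t)) \<or> fst (legs G (fst s)) = snd (legs G (fst t))"
    using eq[OF hs(1)] hs(3) by (auto simp: crossing_seg[OF hs(1)] s t split: if_splits)
  have 2: "snd (legs G (fst s)) = fst (legs G (fst t)) \<or> snd (legs G (fst s)) = snd (legs G (fst t))"
    using eq[OF hs(2)] hs(3) by (auto simp: crossing_seg[OF hs(2)] s t split: if_splits)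
  have "{fst (legs G (fst s)), snd (legs G (fst s))} = {fst (legs G (fst t)), snd (legs G (fst t))}"
    using 1 2 hs(3) by auto
  then have e: "fst s = fst t" using aux_structure s(2) t(2) unfolding auxiliary_structure_def by blast
  have "fst (snd s) < snd (snd s) \<longleftrightarrow> fst (snd t) < snd (snd t)"
    using eq[OF hs(1)] crossing_seg[OF hs(1) s] crossing_seg[OF hs(1) t] hs(3) e by (auto split: if_splits)
  moreover have "full_seg s" "full_seg t" using s t aux_disjoint by (auto dest: valid_segD(6))
  ultimately show ?thesis using e by (auto simp: full_seg_def prod_eq_iff)
qed

end


section \<open>Tripods\<close>

lemma homotopic_paths_cancel_middle:
  fixes p q r :: "real \<Rightarrow> 'a::topological_space"
  assumes "path p" "path_image p \<subseteq> S" "path q" "path_image q \<subseteq> S" "path r" "path_image r \<subseteq> S"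
    and "pathfinish p = pathfinish q" "pathfinish r = pathfinish q"
  shows "homotopic_paths S ((p +++ reversepath q) +++ (q +++ reversepath r)) (p +++ reversepath r)"
proof -
  have j: "path_image (q +++ reversepath r) \<subseteq> S" "path_image (reversepath q +++ q) \<subseteq> S"
    using assms path_image_join_subset[of q "reversepath r"] path_image_join_subset[of "reversepath q" q] by auto
  have "homotopic_paths S ((p +++ reversepath q) +++ (q +++ reversepath r)) (p +++ (reversepath q +++ (q +++ reversepath r)))"
    using assms j by (intro homotopic_paths_sym[OF homotopic_paths_assoc]) auto
  also have "homotopic_paths S \<dots> (p +++ ((reversepath q +++ q) +++ reversepath r))"
    using assms by (intro homotopic_paths_join homotopic_paths_assoc) auto
  also have "homotopic_paths S \<dots> (p +++ ((\<lambda>_. pathfinish q) +++ reversepath r))"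
    using assms homotopic_paths_join_reverse[of "reversepath q" S "pathfinish q"]
    by (intro homotopic_paths_join) auto
  also have "homotopic_paths S \<dots> (p +++ reversepath r)"
    using assms homotopic_paths_const_join[of "reversepath r" S "pathfinish q"]
    by (intro homotopic_paths_join) auto
  finally show ?thesis .
qed

context nielsen_graph begin

text \<open>An auxiliary segment runs along its first leg to the auxiliary vertex and back along its second leg; the
  names refer to the orientation of the segment, not of the edge.\<close>

definition first_leg :: "'e seg \<Rightarrow> 'e" where
  "first_leg s = (if fst (snd s) < snd (snd s) then fst (legs G (fst s)) else snd (legs G (fst s)))"

definition second_leg :: "'e seg \<Rightarrow> 'e" where
  "second_leg s = (if fst (snd s) < snd (snd s) then snd (legs G (fst s)) else fst (legs G (fst s)))"

lemma seg_cells_aux: "fst s \<in> aux G \<Longrightarrow> seg_cells G s = [(first_leg s, 0, 1), (second_leg s, 1, 0)]"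
  by (simp add: seg_cells_def first_leg_def second_leg_def)

lemma seg_legs:
  assumes "fst s \<in> aux G"
  shows "first_leg s \<in> half G" "second_leg s \<in> half G" "first_leg s \<noteq> second_leg s"
    "emap G (first_leg s) 1 = emap G (second_leg s) 1"
    "{first_leg s, second_leg s} = {fst (legs G (fst s)), snd (legs G (fst s))}"
  using legs_half[OF assms] by (auto simp: first_leg_def second_leg_def)

lemma seg_path_legs:
  assumes "valid_seg G s" "fst s \<in> aux G"
  shows "seg_path s = emap G (first_leg s) +++ reversepath (emap G (second_leg s))"
    "seg_start G s = emap G (first_leg s) 0" "seg_end G s = emap G (second_leg s) 0"
proof -
  let ?p = "emap G (fst (legs G (fst s)))" and ?q = "emap G (snd (legs G (fst s)))"
  have e: "edge_map G (fst s) = ?p +++ reversepath ?q" using assms(2) by (simp add: edge_map_def)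
  show *: "seg_path s = emap G (first_leg s) +++ reversepath (emap G (second_leg s))"
    using assms
  proof (cases rule: aux_seg_cases)
    case 1
    then have "fst (snd s) = 0" "snd (snd s) = 1" by (metis fst_conv snd_conv)+
    then show ?thesis by (simp add: seg_path_def e first_leg_def second_leg_def)
  next
    case 2
    then have o: "fst (snd s) = 1" "snd (snd s) = 0" by (metis fst_conv snd_conv)+
    then have "seg_path s = reversepath (?p +++ reversepath ?q)"
      using reversepath_sub_path[of 0 1 "edge_map G (fst s)"] by (simp add: seg_path_def e)
    also have "\<dots> = ?q +++ reversepath ?p"
      using legs_half(4)[OF assms(2)] by (simp add: reversepath_joinpaths pathfinish_def)
    finally show ?thesis using o by (simp add: first_leg_def second_leg_def)
  qed
  show "seg_start G s = emap G (first_leg s) 0" "seg_end G s = emap G (second_leg s) 0"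
    using seg_path_aux(3,4)[OF assms] unfolding * by (auto simp: pathstart_def pathfinish_def joinpaths_def reversepath_def)
qed

lemma aux_seg_with_legs:
  assumes "g \<in> half G" "h \<in> half G" "g \<noteq> h" "emap G g 1 = emap G h 1"
  obtains s where "valid_seg G s" "fst s \<in> aux G" "first_leg s = g" "second_leg s = h"
proof -
  have "\<forall>h\<in>half G. \<forall>h'\<in>half G. h \<noteq> h' \<and> emap G h 1 = emap G h' 1 \<longrightarrow>
        (\<exists>e\<in>aux G. {h, h'} = {fst (legs G e), snd (legs G e)})"
    using aux_structure unfolding auxiliary_structure_def by blast
  then obtain e where e: "e \<in> aux G" "{g, h} = {fst (legs G e), snd (legs G e)}" using assms by meson
  then consider "g = fst (legs G e)" "h = snd (legs G e)" | "g = snd (legs G e)" "h = fst (legs G e)"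
    by (auto simp: doubleton_eq_iff)
  then show ?thesis
  proof cases
    case 1 then show ?thesis using e that[of "(e, 0, 1)"] by (auto simp: valid_seg_def full_seg_def first_leg_def second_leg_def)
  next
    case 2 then show ?thesis using e that[of "(e, 1, 0)"] by (auto simp: valid_seg_def full_seg_def first_leg_def second_leg_def)
  qed
qed

lemma aux_seg_eqI:
  assumes "valid_seg G s" "fst s \<in> aux G" "valid_seg G t" "fst t \<in> aux G"
    "first_leg s = first_leg t" "second_leg s = second_leg t"
  shows "s = t"
proof -
  have "{fst (legs G (fst s)), snd (legs G (fst s))} = {fst (legs G (fst t)), snd (legs G (fst t))}"
    using seg_legs(5)[OF assms(2)] seg_legs(5)[OF assms(4)] assms(5,6) by simp
  then have e: "fst s = fst t" using aux_structure assms(2,4) unfolding auxiliary_structure_def by blast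
  have "fst (snd s) < snd (snd s) \<longleftrightarrow> fst (snd t) < snd (snd t)"
    using assms(5) e legs_half(3)[OF assms(4)] by (auto simp: first_leg_def split: if_splits)
  moreover have "full_seg s" "full_seg t" using assms aux_disjoint by (auto dest: valid_segD(6))
  ultimately show ?thesis using e by (auto simp: full_seg_def prod_eq_iff)
qed

text \<open>The two edges have the same auxiliary vertex and three distinct legs between them. The auxiliary edge formed by the
  outer two legs is homotopic to their composition, in which the common leg cancels.\<close>

lemma tripod:
  assumes s: "valid_seg G s" "fst s \<in> aux G" and t: "valid_seg G t" "fst t \<in> aux G"
    and common: "second_leg s = first_leg t" and ne: "t \<noteq> rev_seg s"
  obtains r where "valid_seg G r" "fst r \<in> aux G" "seg_start G r = seg_start G s" "seg_end G r = seg_end G t"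
    "homotopic_words (seg_start G s) [s, t] [r]"
proof -
  note ls = seg_legs[OF s(2)] and lt = seg_legs[OF t(2)]
  have rs: "valid_seg G (rev_seg s)" "fst (rev_seg s) \<in> aux G" using valid_segD(5)[OF s(1)] s(2) by auto
  have "first_leg (rev_seg s) = second_leg s" "second_leg (rev_seg s) = first_leg s"
    using valid_segD(4)[OF s(1)] by (auto simp: first_leg_def second_leg_def nontrivial_seg_def)
  then have "first_leg s \<noteq> second_leg t" using aux_seg_eqI[OF t rs] common ne by auto
  then obtain r where r: "valid_seg G r" "fst r \<in> aux G" "first_leg r = first_leg s" "second_leg r = second_leg t"
    using aux_seg_with_legs[of "first_leg s" "second_leg t"] ls lt common by metis
  have st: "seg_start G r = seg_start G s" "seg_end G r = seg_end G t" "seg_end G s = seg_start G t"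
    using seg_path_legs(2,3) r s t common by auto
  have w: "walk (seg_start G s) [s] (seg_end G s)" "walk (seg_end G s) [t] (seg_end G t)"
    using s t seg_G2(2)[OF s(1)] seg_G2(2)[OF t(1)] st by auto
  have "homotopic_paths (G2 G) (track G (seg_start G s) ([s] @ [t])) (track G (seg_start G s) [s] +++ track G (seg_end G s) [t])"
    by (rule track_append[OF w])
  also have "homotopic_paths (G2 G) \<dots> (seg_path s +++ seg_path t)"
    using track_single[OF s(1)] track_single[OF t(1)] path_track[OF w(1)] path_track[OF w(2)] st
    unfolding seg_path_def by (intro homotopic_paths_join) auto
  also have "homotopic_paths (G2 G) \<dots> (seg_path r)"
    unfolding seg_path_legs(1)[OF s] seg_path_legs(1)[OF t] seg_path_legs(1)[OF r(1,2)] r common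
    using half_path[OF ls(1)] half_path[OF ls(2)] half_path[OF lt(2)] rel_part_G2 ls(4) lt(4) common
    by (intro homotopic_paths_cancel_middle) (auto simp: pathfinish_def)
  also have "homotopic_paths (G2 G) \<dots> (track G (seg_start G s) [r])"
    using homotopic_paths_sym[OF track_single[OF r(1)]] st by (simp add: seg_path_def)
  finally show ?thesis using that[OF r(1,2) st(1,2)] by (simp add: homotopic_words_def)
qed

end

section \<open>Words over auxiliary edges and their retractions\<close>

context beta_map begin

lemma ret_word_simps [simp]: "ret_word G [] = []" "ret_word G (s # w) = ret_seg G s @ ret_word G w"
  "ret_word G (u @ v) = ret_word G u @ ret_word G v"
  by (simp_all add: ret_word_def)

lemma ret_seg_not_aux: "fst s \<notin> aux G \<Longrightarrow> ret_seg G s = [s]"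
  by (simp add: ret_seg_def)

text \<open>Otherwise the auxiliary edge would be a null-homotopic loop.\<close>

lemma ret_seg_nonempty:
  assumes "valid_seg G s" shows "ret_seg G s \<noteq> []"
proof (cases "fst s \<in> aux G")
  case True
  then show ?thesis using aux_not_null[OF assms True] ret_seg_homotopic[OF assms] by force
qed (simp add: ret_seg_not_aux)

text \<open>Segments with equal retractions are homotopic in \<open>\<G>\<^sup>2\<close>, both being homotopic to the common retraction.\<close>

lemma ret_seg_inj:
  assumes s: "valid_seg G s" "fst s \<in> aux G" and t: "valid_seg G t" "fst t \<in> aux G" and eq: "ret_seg G s = ret_seg G t"
  shows "s = t"
proof (rule aux_homotopic_unique[OF s t])
  note hs = ret_seg_homotopic[OF s(1)] and ht = ret_seg_homotopic[OF t(1)]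
  show st: "seg_start G t = seg_start G s" "seg_end G t = seg_end G s"
    using walk_successively(2,3)[OF conjunct1[OF hs]] walk_successively(2,3)[OF conjunct1[OF ht]] ret_seg_nonempty s t eq by auto
  show "homotopic_words (seg_start G s) [s] [t]" using hs ht eq st by (auto intro: homotopic_words_trans homotopic_words_sym)
qed

lemma valid_aux_full: "fst s \<in> aux G \<Longrightarrow> full_seg s \<Longrightarrow> valid_seg G s"
  by (simp add: valid_seg_def)

text \<open>Occurrences as factorisations of the word, which is easier to work with than the index form.\<close>

lemma pre_INP_occurrence_iff:
  "pre_INP_occurrence G W (i, s) \<longleftrightarrow>
     fst s \<in> aux G \<and> full_seg s \<and> (\<exists>u v. W = u @ ret_seg G s @ v \<and> length u = i)"
proof (safe)
  assume "pre_INP_occurrence G W (i, s)"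
  then show "fst s \<in> aux G" "full_seg s" by (auto simp: pre_INP_occurrence_def)
  have l: "i + length (ret_seg G s) \<le> length W" "take (length (ret_seg G s)) (drop i W) = ret_seg G s"
    using \<open>pre_INP_occurrence G W (i, s)\<close> by (auto simp: pre_INP_occurrence_def subword_def drop_take)
  have "W = take i W @ take (length (ret_seg G s)) (drop i W) @ drop (length (ret_seg G s)) (drop i W)"
    by (simp only: append_take_drop_id)
  with l show "\<exists>u v. W = u @ ret_seg G s @ v \<and> length u = i"
    by (intro exI[of _ "take i W"] exI[of _ "drop (length (ret_seg G s)) (drop i W)"]) auto
qed (auto simp: pre_INP_occurrence_def subword_def)

lemma isolated_valid: "isolated_pre_INP G W (i, s) \<Longrightarrow> fst s \<in> aux G \<and> valid_seg G s"
  by (auto simp: isolated_pre_INP_def pre_INP_occurrence_iff valid_aux_full)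

lemma isolated_bound: "isolated_pre_INP G W (i, s) \<Longrightarrow> i + length (ret_seg G s) \<le> length W"
  by (auto simp: isolated_pre_INP_def pre_INP_occurrence_def)

lemma isolated_drop:
  assumes "isolated_pre_INP G W (i, s)" shows "drop i W = ret_seg G s @ drop (i + length (ret_seg G s)) W"
proof -
  obtain u v where "W = u @ ret_seg G s @ v" "length u = i"
    using assms by (auto simp: isolated_pre_INP_def pre_INP_occurrence_iff)
  then show ?thesis by auto
qed

lemma isolatedD:
  assumes "isolated_pre_INP G W (i, s)" "pre_INP_occurrence G W (j, t)"
    "{i..<i + length (ret_seg G s)} \<inter> {j..<j + length (ret_seg G t)} \<noteq> {}"
  shows "{j..<j + length (ret_seg G t)} \<subseteq> {i..<i + length (ret_seg G s)}"
  using assms unfolding isolated_pre_INP_def by blast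

lemma isolated_take:
  assumes "isolated_pre_INP G W (i, s)" shows "take (length (ret_seg G s)) (drop i W) = ret_seg G s"
proof -
  have "pre_INP_occurrence G W (i, s)" using assms unfolding isolated_pre_INP_def by blast
  then show ?thesis by (simp add: pre_INP_occurrence_def subword_def drop_take)
qed

text \<open>If two isolated occurrences overlap, each contains the other, so they occupy the same positions
  and are occurrences of the same word, which determines the segment by \<open>ret_seg_inj\<close>.\<close>

lemma isolated_disjoint:
  assumes s: "isolated_pre_INP G W (i, s)" and t: "isolated_pre_INP G W (j, t)"
    and "i < j + length (ret_seg G t)" "j < i + length (ret_seg G s)"
  shows "i = j \<and> s = t"
proof -
  let ?a = "length (ret_seg G s)" and ?b = "length (ret_seg G t)"
  have vs: "valid_seg G s" "fst s \<in> aux G" and vt: "valid_seg G t" "fst t \<in> aux G"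
    using isolated_valid[OF s] isolated_valid[OF t] by auto
  have n: "?a > 0" "?b > 0" using ret_seg_nonempty vs vt by auto
  have "max i j \<in> {i..<i + ?a} \<inter> {j..<j + ?b}" using assms(3,4) n by (auto simp: max_def)
  then have ne: "{i..<i + ?a} \<inter> {j..<j + ?b} \<noteq> {}" "{j..<j + ?b} \<inter> {i..<i + ?a} \<noteq> {}"
    by (metis Int_commute empty_iff)+
  have occ: "pre_INP_occurrence G W (i, s)" "pre_INP_occurrence G W (j, t)"
    using s t unfolding isolated_pre_INP_def by blast+
  have 1: "j + ?b \<le> j \<or> i \<le> j \<and> j + ?b \<le> i + ?a"
    using isolatedD[OF s occ(2) ne(1)] by (simp only: ivl_subset)
  have 2: "i + ?a \<le> i \<or> j \<le> i \<and> i + ?a \<le> j + ?b"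
    using isolatedD[OF t occ(1) ne(2)] by (simp only: ivl_subset)
  have eq: "i = j" "?a = ?b" using 1 2 n by linarith+
  have "ret_seg G s = take ?a (drop i W)" by (rule isolated_take[OF s, symmetric])
  also have "\<dots> = take ?b (drop j W)" by (simp only: eq)
  also have "\<dots> = ret_seg G t" by (rule isolated_take[OF t])
  finally have "ret_seg G s = ret_seg G t" .
  then show ?thesis using ret_seg_inj[OF vs vt] eq(1) by blast
qed

text \<open>The positions of auxiliary edges, measured in the retracted word and shifted by \<open>k\<close>; the recursive form of the set
  in the definition of normalized paths.\<close>

primrec aux_positions :: "nat \<Rightarrow> 'e seg list \<Rightarrow> (nat \<times> 'e seg) set" where
  "aux_positions k [] = {}"
| "aux_positions k (s # w) =
    (if fst s \<in> aux G then {(k, s)} else {}) \<union> aux_positions (k + length (ret_seg G s)) w"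

lemma aux_positions_eq:
  "{(k + length (ret_word G (take j w)), w ! j) | j. j < length w \<and> fst (w ! j) \<in> aux G} = aux_positions k w"
proof (induction w arbitrary: k)
  case (Cons s w)
  let ?P = "\<lambda>k w j. (k + length (ret_word G (take j w)), w ! j)"
  have "{?P k (s # w) j | j. j < length (s # w) \<and> fst ((s # w) ! j) \<in> aux G} =
    (if fst s \<in> aux G then {(k, s)} else {}) \<union>
    {?P (k + length (ret_seg G s)) w j | j. j < length w \<and> fst (w ! j) \<in> aux G}" (is "?L = ?R")
  proof (intro equalityI subsetI)
    fix p assume "p \<in> ?L"
    then obtain j where j: "p = ?P k (s # w) j" "j < length (s # w)" "fst ((s # w) ! j) \<in> aux G" by blast
    then show "p \<in> ?R" by (cases j) (auto simp: add.assoc)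
  next
    fix p assume "p \<in> ?R"
    then consider "fst s \<in> aux G" "p = (k, s)"
      | j where "p = ?P (k + length (ret_seg G s)) w j" "j < length w" "fst (w ! j) \<in> aux G"
      by (auto split: if_splits)
    then show "p \<in> ?L"
    proof cases
      case 1 then show ?thesis by (intro CollectI exI[of _ 0]) auto
    next
      case (2 j) then show ?thesis by (intro CollectI exI[of _ "Suc j"]) (auto simp: add.assoc)
    qed
  qed
  then show ?case using Cons.IH by simp
qed simp

lemma aux_positions_ge: "(i, s) \<in> aux_positions k w \<Longrightarrow> k \<le> i"
  by (induction w arbitrary: k) (force split: if_splits)+

lemma aux_positions_append:
  "aux_positions k (u @ v) = aux_positions k u \<union> aux_positions (k + length (ret_word G u)) v"
  by (induction u arbitrary: k) (auto simp: add.assoc)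

text \<open>Both words can be read off from left to right: the positions tell whether the next letter is an auxiliary
  edge, and which one, and otherwise it is the next letter of the retracted word. As retractions of segments are not empty,
  no two letters share a position.\<close>

lemma word_from_positions:
  assumes "\<forall>s\<in>set v. valid_seg G s" "\<forall>s\<in>set w. valid_seg G s"
    and "ret_word G v = ret_word G w" "aux_positions k v = aux_positions k w"
  shows "v = w"
  using assms
proof (induction v arbitrary: w k)
  case Nil
  then show ?case using ret_seg_nonempty by (cases w) auto
next
  case (Cons s v)
  have s: "valid_seg G s" using Cons.prems by simp
  obtain t w' where w: "w = t # w'"
    using Cons.prems(3) ret_seg_nonempty[OF s] by (cases w) auto
  have t: "valid_seg G t" using Cons.prems w by simp
  have n: "(k, r) \<notin> aux_positions (k + length (ret_seg G s)) u" "(k, r) \<notin> aux_positions (k + length (ret_seg G t)) u" for r u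
    using aux_positions_ge[of k r _ u] ret_seg_nonempty[OF s] ret_seg_nonempty[OF t] by fastforce+
  have st: "s = t"
  proof (cases "fst s \<in> aux G \<or> fst t \<in> aux G")
    case True
    then have "(k, s) \<in> aux_positions k (t # w') \<or> (k, t) \<in> aux_positions k (s # v)"
      using Cons.prems(4) w by auto
    then show ?thesis using n by (auto split: if_splits)
  next
    case False
    then show ?thesis using Cons.prems(3) by (simp add: w ret_seg_not_aux)
  qed
  have "aux_positions (k + length (ret_seg G s)) v = aux_positions (k + length (ret_seg G s)) w'"
  proof (cases "fst s \<in> aux G")
    case True
    then have "insert (k, s) (aux_positions (k + length (ret_seg G s)) v) = insert (k, s) (aux_positions (k + length (ret_seg G s)) w')"
      using Cons.prems(4) by (simp add: w st)
    then show ?thesis using n by (metis insert_ident)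
  next
    case False
    then show ?thesis using Cons.prems(4) by (simp add: w st)
  qed
  then have "v = w'" using Cons.IH[of w'] Cons.prems w st by auto
  then show ?case by (simp add: w st)
qed

lemma walk_of_ret_word:
  assumes "\<forall>s\<in>set w. valid_seg G s" "walk x (ret_word G w) y" shows "walk x w y"
  using assms
proof (induction w arbitrary: x)
  case (Cons s w)
  then obtain z where z: "walk x (ret_seg G s) z" "walk z (ret_word G w) y" by (auto simp: walk_append)
  have s: "valid_seg G s" using Cons.prems by simp
  have "x = seg_start G s \<and> z = seg_end G s"
    using walk_successively(2,3)[OF z(1)] walk_successively(2,3)[OF conjunct1[OF ret_seg_homotopic[OF s]]] ret_seg_nonempty[OF s] by auto
  then show ?case using Cons z s by auto
qed simp

text \<open>The word is built from position \<open>k\<close> to the right, where \<open>k\<close> must not lie inside an isolated occurrence. If one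
  starts at \<open>k\<close>, its auxiliary edge is emitted and the occurrence is skipped, which by disjointness skips no other one.\<close>

lemma replace_isolated:
  assumes W: "in_Gamma G W" "\<forall>s\<in>set W. valid_seg G s"
    and "k \<le> length W" "\<And>i s. isolated_pre_INP G W (i, s) \<Longrightarrow> i + length (ret_seg G s) \<le> k \<or> k \<le> i"
  shows "\<exists>w. ret_word G w = drop k W \<and> (\<forall>s\<in>set w. valid_seg G s) \<and>
    aux_positions k w = {(i, s). isolated_pre_INP G W (i, s) \<and> k \<le> i}"
  using assms(3,4)
proof (induction "length W - k" arbitrary: k rule: less_induct)
  case less
  have pos: "length (ret_seg G s) > 0" if "isolated_pre_INP G W (i, s)" for i s
    using isolated_valid[OF that] ret_seg_nonempty by auto
  consider "k = length W" | s where "k < length W" "isolated_pre_INP G W (k, s)"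
    | "k < length W" "\<And>s. \<not> isolated_pre_INP G W (k, s)" using less.prems(1) by fastforce
  then show ?case
  proof cases
    case 1
    have "\<not> (isolated_pre_INP G W (i, s) \<and> k \<le> i)" for i s
    proof
      assume a: "isolated_pre_INP G W (i, s) \<and> k \<le> i"
      then have "i + length (ret_seg G s) \<le> length W" "length (ret_seg G s) > 0"
        using isolated_bound pos by blast+
      with a 1 show False by linarith
    qed
    then show ?thesis using 1 by (intro exI[of _ "[]"]) auto
  next
    case (2 s)
    let ?k = "k + length (ret_seg G s)"
    have nocross: "i + length (ret_seg G t) \<le> k \<or> ?k \<le> i \<or> (i = k \<and> t = s)"
      if "isolated_pre_INP G W (i, t)" for i t
      using isolated_disjoint[OF 2(2) that] by (metis not_le)
    have "\<exists>w. ret_word G w = drop ?k W \<and> (\<forall>s\<in>set w. valid_seg G s) \<and>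
      aux_positions ?k w = {(i, s). isolated_pre_INP G W (i, s) \<and> ?k \<le> i}"
    proof (rule less.hyps)
      show "length W - ?k < length W - k" using 2(1) pos[OF 2(2)] by linarith
      show "?k \<le> length W" using isolated_bound[OF 2(2)] .
      show "i + length (ret_seg G t) \<le> ?k \<or> ?k \<le> i" if "isolated_pre_INP G W (i, t)" for i t
        using nocross[OF that] by auto
    qed
    then obtain w where w: "ret_word G w = drop ?k W" "\<forall>s\<in>set w. valid_seg G s"
      "aux_positions ?k w = {(i, s). isolated_pre_INP G W (i, s) \<and> ?k \<le> i}" by blast
    have "(i, t) \<in> aux_positions k (s # w) \<longleftrightarrow> isolated_pre_INP G W (i, t) \<and> k \<le> i" for i t
    proof (cases "isolated_pre_INP G W (i, t)")
      case True
      then have "?k \<le> i \<or> i = k \<and> t = s \<longleftrightarrow> k \<le> i"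
        using nocross[OF True] pos[OF True] by linarith
      with True show ?thesis using w(3) isolated_valid[OF 2(2)] by auto
    next
      case False
      then show ?thesis using w(3) 2(2) by auto
    qed
    then have "aux_positions k (s # w) = {(i, s). isolated_pre_INP G W (i, s) \<and> k \<le> i}"
      by (intro equalityI subrelI) (simp_all del: aux_positions.simps)
    then show ?thesis using w isolated_valid[OF 2(2)] isolated_drop[OF 2(2)]
      by (intro exI[of _ "s # w"]) auto
  next
    case 3
    have "\<exists>w. ret_word G w = drop (Suc k) W \<and> (\<forall>s\<in>set w. valid_seg G s) \<and>
      aux_positions (Suc k) w = {(i, s). isolated_pre_INP G W (i, s) \<and> Suc k \<le> i}"
    proof (rule less.hyps)
      show "i + length (ret_seg G t) \<le> Suc k \<or> Suc k \<le> i" if "isolated_pre_INP G W (i, t)" for i t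
        using less.prems(2)[OF that] 3(2)[of t] that by (cases "i = k") auto
    qed (use 3 in auto)
    then obtain w where w: "ret_word G w = drop (Suc k) W" "\<forall>s\<in>set w. valid_seg G s"
      "aux_positions (Suc k) w = {(i, s). isolated_pre_INP G W (i, s) \<and> Suc k \<le> i}" by blast
    have "W ! k \<in> set W" using 3(1) by simp
    then have v: "fst (W ! k) \<notin> aux G" "valid_seg G (W ! k)"
      using W aux_disjoint by (auto simp: in_Gamma_def)
    have "{(i, s). isolated_pre_INP G W (i, s) \<and> Suc k \<le> i} = {(i, s). isolated_pre_INP G W (i, s) \<and> k \<le> i}"
      using 3(2) by (auto simp: Suc_le_eq le_less)
    then show ?thesis using w v 3(1)
      by (intro exI[of _ "W ! k # w"]) (auto simp: ret_seg_not_aux Cons_nth_drop_Suc)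
  qed
qed

end

section \<open>Normalized paths\<close>

lemma successively_splitI:
  "(\<And>u s t v. w = u @ s # t # v \<Longrightarrow> P s t) \<Longrightarrow> successively P w"
proof (induction w)
  case (Cons s w)
  have "successively P w"
  proof (rule Cons.IH)
    fix u a c v assume "w = u @ a # c # v"
    then show "P a c" using Cons.prems[of "s # u"] by simp
  qed
  moreover have "P s (hd w)" if "w \<noteq> []"
    using Cons.prems[of "[]" s "hd w" "tl w"] that by simp
  ultimately show ?case by (auto simp: successively_Cons)
qed simp

lemma successively_concat:
  assumes "\<forall>s\<in>set w. \<phi> s \<noteq> [] \<and> successively Q (\<phi> s)" "successively (\<lambda>s t. Q (last (\<phi> s)) (hd (\<phi> t))) w"
  shows "successively Q (concat (map \<phi> w))"
  using assms
proof (induction w)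
  case (Cons s w)
  then show ?case by (cases w) (auto simp: successively_append_iff successively_Cons)
qed simp

context beta_map begin

lemma normalized_iff:
  "normalized G (x, w) \<longleftrightarrow> is_path G (x, w) \<and> reduced_word G (ret_word G w) \<and>
     aux_positions 0 w = {(i, s). isolated_pre_INP G (ret_word G w) (i, s)}"
  using aux_positions_eq[of 0 w] by (simp add: normalized_def Let_def)

lemma normalized_unique:
  assumes "normalized G (x, v)" "normalized G (x, w)" "homotopic_words x v w" shows "v = w"
proof -
  have p: "is_path G (x, v)" "is_path G (x, w)" using assms(1,2) by (simp_all only: normalized_iff)
  obtain y where v: "walk x v y" using p(1) by (rule is_path_walk)
  obtain y' where w: "walk x w y'" using p(2) by (rule is_path_walk)
  have y: "y' = y" using homotopic_paths_imp_pathfinish[OF assms(3)[unfolded homotopic_words_def]] path_track(4)[OF v] path_track(4)[OF w] by simp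
  note rv = ret_word_homotopic[OF v] and rw = ret_word_homotopic[OF w[unfolded y]]
  have "ret_word G v = ret_word G w"
  proof (rule tight_unique[OF rv(1) rw(1) rv(3) rw(3)])
    show "tight (ret_word G v)" "tight (ret_word G w)"
      using assms(1,2) reduced_word_tight[OF rv(3,1)] reduced_word_tight[OF rw(3,1)] by (simp_all only: normalized_iff)
    show "homotopic_words x (ret_word G v) (ret_word G w)"
      using homotopic_words_trans[OF homotopic_words_trans[OF homotopic_words_sym[OF rv(2)] assms(3)] rw(2)] .
  qed
  moreover from this have "aux_positions 0 v = aux_positions 0 w"
    using assms(1,2) by (simp only: normalized_iff)
  ultimately show ?thesis
    using walk_valid[OF v] walk_valid[OF w] by (intro word_from_positions[of v w 0]) blast+
qed

text \<open>Two adjacent segments that are not auxiliary are adjacent in the reduced word, and a half-edge is different from every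
  edge of \<open>\<Gamma>\<close>, so only two auxiliary edges \<open>s\<close>, \<open>t\<close> with a common leg need an argument. If \<open>t\<close> is the inverse of
  \<open>s\<close>, then the retracted word backtracks between them. Otherwise the third side \<open>r\<close> of the tripod is homotopic to
  \<open>st\<close>, and \<open>tight_unique\<close> makes its pre-INP the concatenation of those of \<open>s\<close> and \<open>t\<close>. So the occurrence of \<open>s\<close>
  meets a pre-INP that it does not contain, and is not isolated.\<close>

lemma isolated_no_backtrack:
  assumes w: "\<forall>s\<in>set w. valid_seg G s" "tight (ret_word G w)"
    and iso: "aux_positions 0 w = {(i, s). isolated_pre_INP G (ret_word G w) (i, s)}"
    and split: "w = u @ s # t # v" and st: "seg_end G s = seg_start G t"
  shows "\<not> backtrack s t" "\<not> backtrack (last (seg_cells G s)) (hd (seg_cells G t))"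
proof -
  have vs: "valid_seg G s" "valid_seg G t" using w(1) split by auto
  have ne: "ret_seg G s \<noteq> []" "ret_seg G t \<noteq> []" using ret_seg_nonempty vs by auto
  have tight: "tight (ret_seg G s @ ret_seg G t)" using w(2) ne by (simp add: split tight_append)
  have "\<not> backtrack s t \<and> \<not> backtrack (last (seg_cells G s)) (hd (seg_cells G t))"
  proof (cases "fst s \<in> aux G"; cases "fst t \<in> aux G")
    assume n: "fst s \<notin> aux G" "fst t \<notin> aux G"
    then show ?thesis using tight by (simp add: ret_seg_not_aux seg_cells_def tight_Cons)
  next
    assume n: "fst s \<notin> aux G" "fst t \<in> aux G"
    then show ?thesis using seg_legs(1)[OF n(2)] valid_segD(1)[OF vs(1)] half_disjoint
      by (auto simp: seg_cells_aux) (auto simp: backtrack_def seg_cells_def)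
  next
    assume n: "fst s \<in> aux G" "fst t \<notin> aux G"
    then show ?thesis using seg_legs(2)[OF n(1)] valid_segD(1)[OF vs(2)] half_disjoint
      by (auto simp: seg_cells_aux) (auto simp: backtrack_def seg_cells_def)
  next
    assume n: "fst s \<in> aux G" "fst t \<in> aux G"
    have not_rev: "t \<noteq> rev_seg s"
    proof
      assume t: "t = rev_seg s"
      have "ret_seg G t = rev_word (ret_seg G s)"
        using n valid_segD(4)[OF vs(1)] by (auto simp: t ret_seg_def nontrivial_seg_def)
      then have "hd (ret_seg G t) = rev_seg (last (ret_seg G s))"
        using ne by (simp add: rev_word_def hd_rev last_map)
      then show False using tight ne by (simp add: tight_append backtrack_def)
    qed
    have full: "full_seg s" "full_seg t" using vs n aux_disjoint by (auto dest: valid_segD(6))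
    then have "\<not> backtrack s t" using not_rev by (auto simp: backtrack_def full_seg_def rev_seg_def prod_eq_iff)
    moreover have "second_leg s \<noteq> first_leg t"
    proof
      assume "second_leg s = first_leg t"
      from tripod[OF vs(1) n(1) vs(2) n(2) this not_rev] obtain r where
        r: "valid_seg G r" "fst r \<in> aux G" "seg_start G r = seg_start G s" "seg_end G r = seg_end G t"
          "homotopic_words (seg_start G s) [s, t] [r]" .
      have wst: "walk (seg_start G s) [s, t] (seg_end G t)" using vs st seg_G2 by auto
      note rst = ret_word_homotopic[OF wst] and rr = ret_seg_homotopic[OF r(1)]
      have "ret_word G [s, t] = ret_seg G r"
      proof (rule tight_unique[OF rst(1) _ rst(3)])
        show "walk (seg_start G s) (ret_seg G r) (seg_end G t)" using rr r by simp
        show "homotopic_words (seg_start G s) (ret_word G [s, t]) (ret_seg G r)"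
          using homotopic_words_trans[OF homotopic_words_trans[OF homotopic_words_sym[OF rst(2)] r(5)]] rr r by simp
      qed (use tight ret_seg_Gamma[OF r(1)] in auto)
      then have occ: "ret_seg G r = ret_seg G s @ ret_seg G t" by simp
      let ?i = "length (ret_word G u)"
      have "(?i, s) \<in> aux_positions 0 w" using n by (simp add: split aux_positions_append)
      then have isol: "isolated_pre_INP G (ret_word G w) (?i, s)" using iso by auto
      have "full_seg r" using r(1,2) aux_disjoint by (auto dest: valid_segD(6))
      then have "pre_INP_occurrence G (ret_word G w) (?i, r)"
        unfolding pre_INP_occurrence_iff using r(2)
        by (intro conjI exI[of _ "ret_word G u"] exI[of _ "ret_word G v"]) (simp_all add: split occ)
      moreover have "?i \<in> {?i..<?i + length (ret_seg G s)} \<inter> {?i..<?i + length (ret_seg G r)}"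
        using ne by (simp add: occ)
      ultimately have "{?i..<?i + length (ret_seg G r)} \<subseteq> {?i..<?i + length (ret_seg G s)}"
        using isolatedD[OF isol, of ?i r] by blast
      then show False using ne by (simp add: occ ivl_subset)
    qed
    ultimately show ?thesis using n by (simp add: seg_cells_aux backtrack_def)
  qed
  then show "\<not> backtrack s t" "\<not> backtrack (last (seg_cells G s)) (hd (seg_cells G t))" by auto
qed

lemma normalized_exists:
  assumes "is_path G (x, w)"
  obtains w' where "normalized G (x, w')" "homotopic_words x w' w"
proof -
  obtain y where w: "walk x w y" using assms by (rule is_path_walk)
  note r = ret_word_homotopic[OF w]
  let ?W = "tighten (ret_word G w) []"
  have y: "walk y [] y" using walk_G2[OF w] by simp
  have W: "walk x ?W y" "in_Gamma G ?W" "tight ?W" "homotopic_words x w ?W"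
    using walk_tighten[OF r(1) y] in_Gamma_tighten[OF r(3)] tight_tighten[OF _ walk_nontrivial[OF r(1)]]
      homotopic_words_trans[OF r(2)] homotopic_words_tighten[OF r(1) y] by auto
  obtain v where v: "ret_word G v = ?W" "\<forall>s\<in>set v. valid_seg G s"
    "aux_positions 0 v = {(i, s). isolated_pre_INP G (ret_word G v) (i, s)}"
    using replace_isolated[OF W(2), of 0] walk_valid[OF W(1)] by auto
  have vw: "walk x v y" using walk_of_ret_word[OF v(2)] v(1) W(1) by simp
  have nb: "\<not> backtrack s t \<and> \<not> backtrack (last (seg_cells G s)) (hd (seg_cells G t))" if "v = u @ s # t # u'" for u s t u'
  proof -
    have "seg_end G s = seg_start G t"
      using walk_successively(1)[OF vw] that by (auto simp: successively_append_iff)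
    then show ?thesis using isolated_no_backtrack[OF v(2) _ v(3) that] v(1) W(3) by auto
  qed
  have j: "joined G v" using nb by (intro walk_joined[OF vw] successively_splitI) blast
  let ?Q = "\<lambda>a c. fst a \<notin> hat G \<longrightarrow> \<not> backtrack a c"
  have "successively ?Q (word_cells G v)"
    unfolding word_cells_def
  proof (rule successively_concat)
    show "\<forall>s\<in>set v. seg_cells G s \<noteq> [] \<and> successively ?Q (seg_cells G s)"
    proof
      fix s show "seg_cells G s \<noteq> [] \<and> successively ?Q (seg_cells G s)"
      proof (cases "fst s \<in> aux G")
        case True
        then show ?thesis using seg_legs(3)[OF True] by (simp add: seg_cells_aux backtrack_def)
      qed (simp add: seg_cells_def)
    qed
    show "successively (\<lambda>s t. ?Q (last (seg_cells G s)) (hd (seg_cells G t))) v"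
      using nb by (intro successively_splitI) blast
  qed
  then have "rel_part_reduced G v" by (simp add: rel_part_reduced_def Let_def successively_conv_nth)
  then have "is_path G (x, v)"
    using assms j v(2) walk_successively(2)[OF vw] by (auto simp: is_path_def)
  moreover have "reduced_word G (ret_word G v)" using reduced_word_tight[OF W(2,1)] W(3) v(1) by simp
  ultimately have "normalized G (x, v)" using v(3) by (simp add: normalized_iff)
  moreover have "homotopic_words x v w" using ret_word_homotopic(2)[OF vw] v(1) W(4) by (auto intro: homotopic_words_trans homotopic_words_sym)
  ultimately show ?thesis by (rule that)
qed

end

theorem proposition6p2:
  fixes G :: "('a::t2_space, 'e) nielsen_complex"
    and f :: "'a \<Rightarrow> 'a"
    and F :: "('g, 'm) monoid_scheme"
    and B :: "'g set"
    and \<alpha> :: "'g \<Rightarrow> 'g"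
    and b :: 'a
    and \<theta> :: "(real \<Rightarrow> 'a) set \<Rightarrow> 'g"
    and n :: nat
    and \<gamma> :: "('a, 'e) edge_path"
  assumes "group F" and "free_basis F B" and "card B = n" and "n \<ge> 2"
    and "\<alpha> \<in> iso F F"
    and "beta_train_track_map G f F B \<alpha> b \<theta>"
    and "is_path G \<gamma>"
  shows "\<exists>!\<gamma>'. normalized G \<gamma>' \<and> homotopic_paths (G2 G) (realize G \<gamma>') (realize G \<gamma>)"
proof -
  interpret beta_map G f F B \<alpha> b \<theta> by unfold_locales fact
  obtain x w where \<gamma>: "\<gamma> = (x, w)" by (cases \<gamma>)
  obtain w' where w': "normalized G (x, w')" "homotopic_words x w' w"
    using assms(7) \<gamma> normalized_exists by metis
  show ?thesis
  proof (rule ex1I[of _ "(x, w')"])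
    show "normalized G (x, w') \<and> homotopic_paths (G2 G) (realize G (x, w')) (realize G \<gamma>)"
      using w' by (simp add: homotopic_words_def realize_def \<gamma>)
    fix \<delta> assume \<delta>: "normalized G \<delta> \<and> homotopic_paths (G2 G) (realize G \<delta>) (realize G \<gamma>)"
    obtain z v where zv: "\<delta> = (z, v)" by (cases \<delta>)
    obtain y y' where "walk x w y" "walk z v y'"
      using assms(7) \<delta> is_path_walk unfolding \<gamma> zv normalized_iff by metis
    then have "z = x"
      using homotopic_paths_imp_pathstart[OF conjunct2[OF \<delta>]] path_track(3) by (simp add: \<gamma> zv realize_def)
    moreover from this have "homotopic_words x v w'"
      using \<delta> homotopic_words_sym[OF w'(2)] by (auto simp: homotopic_words_def realize_def \<gamma> zv intro: homotopic_paths_trans)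
    ultimately show "\<delta> = (x, w')" using normalized_unique \<delta> w'(1) zv by blast
  qed
qed

end
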